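(* Let $K\subset\mathbb R^2$ be a convex body with boundary of class $C^2$, and let $\delta\in(0,\mathrm{Vol}_2(K))$. If $\Pi_\delta(K)$ is homothetic to $\Gamma_\delta(K)$, and if $\delta$ is such that every chord of flotation cuts off from $\partial K$ an arc whose affine arc length is exactly $\frac13$ of the total affine arc length of $\partial K$, then $K$ is an ellipse.
   Context: A convex body is a compact convex set with non-empty interior. For each unit vector $\boldsymbol\xi$ let $H_{\boldsymbol\xi}$ be the line orthogonal to $\boldsymbol\xi$ such that the half-plane $H_{\boldsymbol\xi}^-$ cuts off from $K$ area exactly $\delta$; the segments $K\cap H_{\boldsymbol\xi}$ are the chords of flotation and the arc cut off is the part of $\partial K$ in $H_{\boldsymbol\xi}^-$. $\Pi_\delta(K)$ is the envelope of the lines $H_{\boldsymbol\xi}$, and $\Gamma_\delta(K)$ is the locus of the centroids of $K\cap H_{\boldsymbol\xi}^-$. Two curves are homothetic if one is the image of the other under a map $x\mapsto q+\lambda(x-q)$ with $\lambda>0$. The affine arc length of an arc $\gamma|_{[a,b]}$ of a regular parametrization $\gamma$ of $\partial K$ is $\int_a^b\det(\gamma'(u),\gamma''(u))^{1/3}\,\mathrm du$. *)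

theory Defs
  imports "HOL-Analysis.Analysis"
begin

definition convex_body :: "(real^2) set \<Rightarrow> bool" where
  "convex_body K \<longleftrightarrow> compact K \<and> convex K \<and> interior K \<noteq> {}"

definition C2_boundary_param :: "(real^2) set \<Rightarrow> real \<Rightarrow> (real \<Rightarrow> real^2) \<Rightarrow> bool" where
  "C2_boundary_param K L \<gamma> \<longleftrightarrow>
     0 < L \<and>
     (\<exists>\<gamma>1 \<gamma>2. (\<forall>t. (\<gamma> has_vector_derivative \<gamma>1 t) (at t)) \<and>
                (\<forall>t. (\<gamma>1 has_vector_derivative \<gamma>2 t) (at t)) \<and>
                continuous_on UNIV \<gamma>2 \<and>
                (\<forall>t. \<gamma>1 t \<noteq> 0)) \<and>
     (\<forall>t. \<gamma> (t + L) = \<gamma> t) \<and>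
     inj_on \<gamma> {0..<L} \<and>
     \<gamma> ` {0..L} = frontier K"

definition has_C2_boundary :: "(real^2) set \<Rightarrow> bool" where
  "has_C2_boundary K \<longleftrightarrow> (\<exists>L \<gamma>. C2_boundary_param K L \<gamma>)"

definition det2 :: "real^2 \<Rightarrow> real^2 \<Rightarrow> real" where
  "det2 u v = u$1 * v$2 - u$2 * v$1"

definition affine_length :: "(real \<Rightarrow> real^2) \<Rightarrow> real set \<Rightarrow> real" where
  "affine_length \<gamma> T =
     integral T (\<lambda>t. root 3 (det2 (vector_derivative \<gamma> (at t))
                      (vector_derivative (\<lambda>s. vector_derivative \<gamma> (at s)) (at t))))"

definition unitvec :: "real \<Rightarrow> real^2" where
  "unitvec \<theta> = vector [cos \<theta>, sin \<theta>]"

definition unitvec' :: "real \<Rightarrow> real^2" where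
  "unitvec' \<theta> = vector [- sin \<theta>, cos \<theta>]"

definition halfplane :: "real^2 \<Rightarrow> real \<Rightarrow> (real^2) set" where
  "halfplane \<xi> s = {x. x \<bullet> \<xi> \<le> s}"

definition flot_level :: "(real^2) set \<Rightarrow> real \<Rightarrow> real \<Rightarrow> real" where
  "flot_level K \<delta> \<theta> = (THE s. measure lebesgue (K \<inter> halfplane (unitvec \<theta>) s) = \<delta>)"

text \<open>Envelope of the family of lines x . u(theta) = h(theta).\<close>
definition Pi_delta :: "(real^2) set \<Rightarrow> real \<Rightarrow> (real^2) set" where
  "Pi_delta K \<delta> = {x. \<exists>\<theta>. x \<bullet> unitvec \<theta> = flot_level K \<delta> \<theta> \<and>
                           x \<bullet> unitvec' \<theta> = deriv (flot_level K \<delta>) \<theta>}"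

definition centroid :: "(real^2) set \<Rightarrow> real^2" where
  "centroid S = integral S (\<lambda>x. x) /\<^sub>R measure lebesgue S"

definition Gamma_delta :: "(real^2) set \<Rightarrow> real \<Rightarrow> (real^2) set" where
  "Gamma_delta K \<delta> = range (\<lambda>\<theta>. centroid (K \<inter> halfplane (unitvec \<theta>) (flot_level K \<delta> \<theta>)))"

definition homothetic :: "(real^2) set \<Rightarrow> (real^2) set \<Rightarrow> bool" where
  "homothetic A B \<longleftrightarrow> (\<exists>q r. r > 0 \<and> A = (\<lambda>x. q + r *\<^sub>R (x - q)) ` B)"

definition is_ellipse :: "(real^2) set \<Rightarrow> bool" where
  "is_ellipse K \<longleftrightarrow> (\<exists>(A::real^2^2) c. invertible A \<and> K = (\<lambda>x. c + A *v x) ` cball 0 1)"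

end

theory Submission
  imports Defs
begin

text \<open>
  Let a chord of flotation have end points \<open>p = \<gamma> t\<close> and \<open>q = \<gamma> (F t)\<close>, and put \<open>v = q - p\<close>.
  Constancy of the area cut off says \<open>p' + q' = \<lambda> v\<close>; constancy of the affine arc length cut off
  says \<open>det2 p' p'' = det2 q' q''\<close>, and together they give \<open>\<lambda> = c det2 p' v\<close> with a constant \<open>c\<close>
  (this is the infinitesimal form of the homothety). Since the arcs have one third of the total affine
  length, three consecutive chords close up to an inscribed triangle, and the three relations force
  the tangent at each vertex to be parallel to the opposite side:
  \<open>p1' = f (p2 - p3)\<close>, \<open>p2' = f (p3 - p1)\<close>, \<open>p3' = f (p1 - p2)\<close>. Hence the centroid of the triangle is
  fixed and, in a suitable parameter, \<open>p1\<close> moves about it as a harmonic oscillator, that is, on an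
  ellipse. The boundary may a priori contain segments, where affine arc length does not see the
  motion; these are excluded by comparing the triangles at the two ends of such a segment.
\<close>


subsection \<open>Plane determinants\<close>

text \<open>Origin of \<open>c\<close>: differentiate \<open>p' + q' = lam v\<close> and pair the
  result with \<open>p'\<close> and with \<open>v\<close>. The equality of the affine speeds
  eliminates the unknown \<open>q''\<close>, and with \<open>N = det2 p' v\<close> there remains
  \<open>lam' N = lam N'\<close>. The relation thus obtained is homogeneous in the velocity, so it
  can be carried along consecutive chords. Summing the three resulting determinants gives
  \<open>c S = 1\<close>, where \<open>S\<close> is twice the signed area of the triangle, and then
  the three values of \<open>N\<close> coincide; this is what turns the tangents parallel to the
  sides.

  The obstacle is that \<sigma>, the affine arc length, is at first only weakly increasing: three
  thirds of the total show that the third iterate \<open>P t\<close> of the chord map and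
  \<open>t + L\<close> have the same \<sigma>, not that they are equal. The triangle argument needs
  closing to first order, \<open>P t = t + L\<close> and \<open>P' t = 1\<close>. Both are available
  at the ends of maximal flat arcs, where \<sigma> is strict on one side; this suffices to exclude
  such arcs, after which every parameter is an end of this kind.\<close>

lemma bounded_bilinear_det2: "bounded_bilinear det2"
proof
  fix a a' b b' :: "real^2" and r :: real
  show "det2 (a + a') b = det2 a b + det2 a' b" "det2 a (b + b') = det2 a b + det2 a b'"
    "det2 (r *\<^sub>R a) b = r *\<^sub>R det2 a b" "det2 a (r *\<^sub>R b) = r *\<^sub>R det2 a b"
    by (simp_all add: det2_def algebra_simps)
  show "\<exists>C. \<forall>a b. norm (det2 a b) \<le> norm a * norm b * C"
  proof (intro exI[of _ 2] allI)
    fix a b :: "real^2"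
    have "norm (det2 a b) \<le> \<bar>a$1\<bar> * \<bar>b$2\<bar> + \<bar>a$2\<bar> * \<bar>b$1\<bar>"
      unfolding det2_def real_norm_def
      using abs_triangle_ineq4[of "a$1 * b$2" "a$2 * b$1"] by (simp add: abs_mult)
    also have "\<dots> \<le> norm a * norm b + norm a * norm b"
      by (intro add_mono mult_mono component_le_norm_cart norm_ge_zero abs_ge_zero)
    finally show "norm (det2 a b) \<le> norm a * norm b * 2" by simp
  qed
qed

interpretation det2: bounded_bilinear det2 by (rule bounded_bilinear_det2)

lemma det2_self [simp]: "det2 a a = 0"
  by (simp add: det2_def)

lemma det2_swap: "det2 a b = - det2 b a"
  by (simp add: det2_def)

lemma has_real_derivative_det2:
  assumes "(f has_vector_derivative f') (at x within S)" "(g has_vector_derivative g') (at x within S)"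
  shows "((\<lambda>x. det2 (f x) (g x)) has_real_derivative (det2 (f x) g' + det2 f' (g x))) (at x within S)"
  using det2.has_vector_derivative[OF assms]
  by (simp add: has_real_derivative_iff_has_vector_derivative)

lemma has_real_derivative_det2_right:
  assumes "(g has_vector_derivative g') (at x within S)"
  shows "((\<lambda>x. det2 a (g x)) has_real_derivative det2 a g') (at x within S)"
  using has_real_derivative_det2[OF has_vector_derivative_const assms, of a] by (simp add: det2.zero_left)

lemma has_vector_derivative_compose_real:
  assumes "(g has_vector_derivative g') (at (f x))" "(f has_real_derivative f') (at x within S)"
  shows "((\<lambda>x. g (f x)) has_vector_derivative f' *\<^sub>R g') (at x within S)"
  using vector_diff_chain_within[of f f' x S g g'] assms
  by (auto simp: o_def has_real_derivative_iff_has_vector_derivative intro: has_vector_derivative_at_within)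

lemma DERIV_add_const_id: "((\<lambda>t. t + c) has_real_derivative 1) (at t within S)" for c :: real
  by (auto intro!: derivative_eq_intros)

lemma periodic_add_int:
  fixes f :: "real \<Rightarrow> 'a"
  assumes "\<And>t. f (t + L) = f t"
  shows "f (t + of_int n * L) = f t"
proof -
  have nat: "f (t + real k * L) = f t" for k t
  proof (induction k)
    case (Suc k)
    then show ?case using assms[of "t + real k * L"] by (simp add: algebra_simps)
  qed simp
  show ?thesis
  proof (cases "n \<ge> 0")
    case True
    then show ?thesis using nat[of t "nat n"] by simp
  next
    case False
    then show ?thesis using nat[of "t + of_int n * L" "nat (- n)"] by simp
  qed
qed

text \<open>The counter-clockwise quarter turn. It turns lines and half-planes written with
  \<open>det2\<close> into hyperplanes and half-spaces of the inner product.\<close>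

definition rot :: "real^2 \<Rightarrow> real^2" where
  "rot a = vector [- a$2, a$1]"

lemma det2_eq_inner_rot: "det2 a b = rot a \<bullet> b"
  by (simp add: det2_def rot_def inner_vec_def sum_2)

lemma det2_rot: "det2 a (rot b) = a \<bullet> b"
  by (simp add: det2_def rot_def inner_vec_def sum_2)

lemma rot_eq_0_iff [simp]: "rot a = 0 \<longleftrightarrow> a = 0"
  by (simp add: rot_def vec_eq_iff forall_2 conj_commute)

text \<open>The factor is written as a projection coefficient so that it is visibly differentiable
  when the two vectors depend on a parameter; \<open>chord_velocity\<close> relies on this.\<close>

lemma det2_eq_0_imp_scaleR:
  assumes "det2 a b = 0" "a \<noteq> 0"
  shows "b = ((a \<bullet> b) / (a \<bullet> a)) *\<^sub>R a"
proof -
  have n: "a$1 * a$1 + a$2 * a$2 \<noteq> 0"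
    using assms(2) by (simp add: vec_eq_iff forall_2 sum_squares_eq_zero_iff)
  then show ?thesis
    using assms(1) unfolding det2_def vec_eq_iff forall_2 inner_vec_def sum_2
    by (auto simp: field_simps)
qed

lemma negligible_det2_line:
  assumes "d \<noteq> 0"
  shows "negligible {x. det2 d (x - p) = 0}"
proof -
  have "{x. det2 d (x - p) = 0} = {x. rot d \<bullet> x = rot d \<bullet> p}"
    by (auto simp: det2_eq_inner_rot inner_diff_right)
  then show ?thesis using assms by (simp add: negligible_hyperplane)
qed

text \<open>An antiderivative on the whole line, fixed up to a constant. It serves for area and
  affine arc length alike, whose differences then make sense across period boundaries.\<close>

definition primitive :: "(real \<Rightarrow> real) \<Rightarrow> real \<Rightarrow> real" where
  "primitive f = (SOME F. \<forall>x. (F has_real_derivative f x) (at x))"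

lemma has_real_derivative_primitive:
  assumes "continuous_on UNIV f"
  shows "(primitive f has_real_derivative f x) (at x)"
proof -
  have "\<exists>F. \<forall>x::real. -\<infinity> < ereal x \<longrightarrow> ereal x < \<infinity> \<longrightarrow> (F has_vector_derivative f x) (at x)"
    using assms by (intro einterval_antiderivative) (auto simp: continuous_on_eq_continuous_at)
  then have "\<exists>F. \<forall>x. (F has_real_derivative f x) (at x)"
    by (auto simp: has_real_derivative_iff_has_vector_derivative)
  then show ?thesis unfolding primitive_def by (rule someI2_ex) auto
qed

text \<open>Dominated convergence: when the direction converges, the indicators converge at every
  point off the limiting line, and that line is a null set because the direction is nonzero.\<close>

lemma continuous_measure_cut:
  fixes K :: "(real^2) set" and d :: "real \<Rightarrow> real^2"
  assumes K: "compact K" and d: "continuous_on UNIV d" and nz: "\<And>w. d w \<noteq> 0"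
  shows "continuous_on UNIV (\<lambda>w. measure lebesgue (K \<inter> {x. det2 (d w) (x - p) \<le> 0}))"
proof -
  let ?H = "\<lambda>w. K \<inter> {x. det2 (d w) (x - p) \<le> 0}"
  have comp: "compact (?H w)" for w
  proof (rule compact_Int_closed[OF K])
    have "continuous_on UNIV (\<lambda>x. det2 (d w) (x - p))" by (intro continuous_intros det2.continuous_on)
    then show "closed {x. det2 (d w) (x - p) \<le> 0}"
      by (intro closed_Collect_le) (auto intro: continuous_intros)
  qed
  have int: "measure lebesgue (?H w) = (LINT x|lebesgue. indicat_real (?H w) x)" for w
    using lmeasurable_compact[OF comp[of w]] by (simp add: fmeasurableD)
  have "isCont (\<lambda>w. measure lebesgue (?H w)) w" for w
  proof (subst continuous_at_sequentially, intro allI impI)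
    fix X :: "nat \<Rightarrow> real" assume X: "X \<longlonglongrightarrow> w"
    have "(\<lambda>i. LINT x|lebesgue. indicat_real (?H (X i)) x) \<longlonglongrightarrow> (LINT x|lebesgue. indicat_real (?H w) x)"
    proof (rule integral_dominated_convergence[where w="indicat_real K"])
      show "indicat_real (?H w) \<in> borel_measurable lebesgue" "\<And>i. indicat_real (?H (X i)) \<in> borel_measurable lebesgue"
        using lmeasurable_compact[OF comp] by (auto intro!: borel_measurable_indicator fmeasurableD)
      show "integrable lebesgue (indicat_real K)"
        using lmeasurable_compact[OF K] by (intro integrable_real_indicator) (auto simp: fmeasurable_def)
      show "AE x in lebesgue. norm (indicat_real (?H (X i)) x) \<le> indicat_real K x" for i
        by (auto simp: indicator_def)
      have "AE x in lebesgue. x \<notin> {x. det2 (d w) (x - p) = 0}"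
        using negligible_det2_line[OF nz[of w], of p] by (intro AE_not_in) (simp add: negligible_iff_null_sets)
      then show "AE x in lebesgue. (\<lambda>i. indicat_real (?H (X i)) x) \<longlonglongrightarrow> indicat_real (?H w) x"
      proof eventually_elim
        case (elim x)
        have "(\<lambda>i. d (X i)) \<longlonglongrightarrow> d w"
          using d X by (metis UNIV_I continuous_on_eq_continuous_at isCont_tendsto_compose open_UNIV)
        then have lim: "(\<lambda>i. det2 (d (X i)) (x - p)) \<longlonglongrightarrow> det2 (d w) (x - p)"
          by (intro det2.tendsto tendsto_const)
        have "\<forall>\<^sub>F i in sequentially. indicat_real (?H (X i)) x = indicat_real (?H w) x"
        proof (cases "det2 (d w) (x - p) < 0")
          case True
          from order_tendstoD(2)[OF lim True] show ?thesis
            by eventually_elim (use True in \<open>auto simp: indicator_def\<close>)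
        next
          case False
          then have "0 < det2 (d w) (x - p)" using elim by auto
          from order_tendstoD(1)[OF lim this] show ?thesis
            by eventually_elim (use False elim in \<open>auto simp: indicator_def\<close>)
        qed
        then show ?case by (rule tendsto_eventually)
      qed
    qed
    then show "((\<lambda>w. measure lebesgue (?H w)) \<circ> X) \<longlonglongrightarrow> measure lebesgue (?H w)"
      unfolding int[symmetric] o_def .
  qed
  then show ?thesis by (simp add: continuous_on_eq_continuous_at)
qed

subsection \<open>Chords and caps of a convex body\<close>

text \<open>The assumption \<open>ccw\<close> records two facts at once: tangent lines are
  supporting lines, and the body lies to their left. A clockwise parametrization is reversed before
  the locale is entered.\<close>

locale ccw_body =
  fixes K :: "(real^2) set" and L :: real and \<gamma> \<gamma>1 \<gamma>2 :: "real \<Rightarrow> real^2"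
  assumes compact_K: "compact K" and convex_K: "convex K" and L_pos: "0 < L"
    and deriv_\<gamma>: "\<And>t. (\<gamma> has_vector_derivative \<gamma>1 t) (at t)"
    and deriv_\<gamma>1: "\<And>t. (\<gamma>1 has_vector_derivative \<gamma>2 t) (at t)"
    and cont_\<gamma>2: "continuous_on UNIV \<gamma>2"
    and regular: "\<And>t. \<gamma>1 t \<noteq> 0"
    and periodic: "\<And>t. \<gamma> (t + L) = \<gamma> t"
    and inj_\<gamma>: "inj_on \<gamma> {0..<L}"
    and image_\<gamma>: "\<gamma> ` {0..L} = frontier K"
    and ccw: "\<And>t x. x \<in> K \<Longrightarrow> 0 \<le> det2 (\<gamma>1 t) (x - \<gamma> t)"
begin

lemma isCont_\<gamma>: "isCont \<gamma> t" and isCont_\<gamma>1: "isCont \<gamma>1 t"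
  using deriv_\<gamma> deriv_\<gamma>1 by (auto intro: has_vector_derivative_continuous)

lemma continuous_on_\<gamma>: "continuous_on S \<gamma>" and continuous_on_\<gamma>1: "continuous_on S \<gamma>1"
  using isCont_\<gamma> isCont_\<gamma>1 by (auto intro: continuous_at_imp_continuous_on)

lemma closed_K: "closed K"
  using compact_K by (rule compact_imp_closed)

lemma periodic_int: "\<gamma> (t + of_int n * L) = \<gamma> t"
  by (rule periodic_add_int[of \<gamma> L, OF periodic])

lemma periodic_\<gamma>1: "\<gamma>1 (t + L) = \<gamma>1 t"
proof -
  have "((\<lambda>t. \<gamma> (t + L)) has_vector_derivative \<gamma>1 (t + L)) (at t)"
    using has_vector_derivative_compose_real[OF deriv_\<gamma> DERIV_add_const_id, of L t UNIV] by simp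
  then show ?thesis
    using deriv_\<gamma>[of t] by (simp add: periodic vector_derivative_unique_at)
qed

lemma periodic_\<gamma>2: "\<gamma>2 (t + L) = \<gamma>2 t"
proof -
  have "((\<lambda>t. \<gamma>1 (t + L)) has_vector_derivative \<gamma>2 (t + L)) (at t)"
    using has_vector_derivative_compose_real[OF deriv_\<gamma>1 DERIV_add_const_id, of L t UNIV] by simp
  then show ?thesis
    using deriv_\<gamma>1[of t] by (simp add: periodic_\<gamma>1 vector_derivative_unique_at)
qed

lemma shift_to_period:
  obtains n :: int where "a \<le> t + of_int n * L" "t + of_int n * L < a + L"
proof
  let ?n = "- \<lfloor>(t - a) / L\<rfloor>"
  show "a \<le> t + of_int ?n * L" "t + of_int ?n * L < a + L"
    using floor_divide_lower[OF L_pos, of "t - a"] floor_divide_upper[OF L_pos, of "t - a"]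
    by (simp_all add: algebra_simps)
qed

lemma \<gamma>_in_frontier: "\<gamma> t \<in> frontier K"
proof -
  obtain n :: int where "0 \<le> t + of_int n * L" "t + of_int n * L < 0 + L" by (rule shift_to_period)
  then have "\<gamma> (t + of_int n * L) \<in> frontier K" unfolding image_\<gamma>[symmetric] by auto
  then show ?thesis by (simp add: periodic_int)
qed

lemma \<gamma>_in_K: "\<gamma> t \<in> K"
  using \<gamma>_in_frontier closed_K frontier_subset_closed by blast

lemma \<gamma>_notin_interior: "\<gamma> t \<notin> interior K"
  using \<gamma>_in_frontier by (auto simp: frontier_def)

lemma \<gamma>_surj:
  assumes "x \<in> frontier K"
  obtains \<tau> where "a \<le> \<tau>" "\<tau> < a + L" "\<gamma> \<tau> = x"
proof -
  obtain u where u: "\<gamma> u = x" using assms unfolding image_\<gamma>[symmetric] by auto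
  obtain n :: int where "a \<le> u + of_int n * L" "u + of_int n * L < a + L" by (rule shift_to_period)
  then show thesis using u that[of "u + of_int n * L"] by (simp add: periodic_int)
qed

lemma \<gamma>_inj:
  assumes eq: "\<gamma> s = \<gamma> t" and "t \<le> s" "s < t + L"
  shows "s = t"
proof -
  obtain n :: int where n: "0 \<le> t + of_int n * L" "t + of_int n * L < 0 + L" by (rule shift_to_period)
  let ?t = "t + of_int n * L" and ?s = "s + of_int n * L"
  show ?thesis
  proof (cases "?s < L")
    case True
    have "\<gamma> ?s = \<gamma> ?t" using eq by (simp add: periodic_int)
    then have "?s = ?t" using n assms True by (intro inj_onD[OF inj_\<gamma>]) auto
    then show ?thesis by simp
  next
    case False
    have "\<gamma> (?s - L) = \<gamma> ?t" using eq periodic[of "?s - L"] by (simp add: periodic_int)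
    then have "?s - L = ?t" using n assms False by (intro inj_onD[OF inj_\<gamma>]) auto
    then show ?thesis using assms by simp
  qed
qed

text \<open>Moving an interior point slightly against the left normal keeps it in \<open>K\<close>,
  so the weak inequality \<open>ccw\<close> has slack.\<close>

lemma interior_strict:
  assumes "x \<in> interior K"
  shows "0 < det2 (\<gamma>1 t) (x - \<gamma> t)"
proof -
  obtain e where e: "0 < e" "cball x e \<subseteq> K" using assms mem_interior_cball by blast
  let ?n = "rot (\<gamma>1 t)"
  define c where "c = e / norm ?n"
  have n0: "norm ?n > 0" using regular[of t] by simp
  then have "x - c *\<^sub>R ?n \<in> cball x e" using e(1) by (simp add: dist_norm c_def)
  then have "0 \<le> det2 (\<gamma>1 t) (x - c *\<^sub>R ?n - \<gamma> t)" using e(2) by (intro ccw) auto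
  also have "\<dots> = det2 (\<gamma>1 t) (x - \<gamma> t) - c * (\<gamma>1 t \<bullet> \<gamma>1 t)"
    by (simp add: det2.diff_right det2.scaleR_right det2_rot)
  moreover have "c * (\<gamma>1 t \<bullet> \<gamma>1 t) > 0"
    using e(1) n0 regular[of t] by (simp add: c_def)
  ultimately show ?thesis by linarith
qed

text \<open>The nearer of two frontier points on a ray would lie on the open segment from an
  interior point to a point of the closure, hence in the interior.\<close>

lemma frontier_ray_unique:
  assumes "a \<in> interior K" "a + r *\<^sub>R d \<in> frontier K" "a + r' *\<^sub>R d \<in> frontier K" "0 < r" "0 < r'"
  shows "r = r'"
proof -
  have *: False if "0 < r" "r < r'" "a + r *\<^sub>R d \<in> frontier K" "a + r' *\<^sub>R d \<in> frontier K" for r r'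
  proof -
    have "d \<noteq> 0" using that(3) assms(1) by (auto simp: frontier_def)
    have "a + r *\<^sub>R d = (1 - r / r') *\<^sub>R a + (r / r') *\<^sub>R (a + r' *\<^sub>R d)"
      using that by (simp add: algebra_simps)
    then have "a + r *\<^sub>R d \<in> open_segment a (a + r' *\<^sub>R d)"
      using that \<open>d \<noteq> 0\<close> by (auto simp: in_segment intro!: exI[of _ "r / r'"])
    also have "\<dots> \<subseteq> interior K"
      using that assms(1) convex_K by (intro in_interior_closure_convex_segment) (auto simp: frontier_def)
    finally show False using that(3) by (auto simp: frontier_def)
  qed
  show ?thesis using *[of r r'] *[of r' r] assms by (meson linorder_neqE_linordered_idom)
qed

text \<open>The signed distance to the tangent at \<open>t\<close> vanishes there to first order; a
  negative second derivative would push the curve to the right of its own supporting line.\<close>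

lemma curvature_nonneg: "0 \<le> det2 (\<gamma>1 t) (\<gamma>2 t)"
proof (rule ccontr)
  assume "\<not> ?thesis"
  then have neg: "det2 (\<gamma>1 t) (\<gamma>2 t) < 0" by simp
  let ?f = "\<lambda>s. det2 (\<gamma>1 t) (\<gamma> s - \<gamma> t)" and ?f' = "\<lambda>s. det2 (\<gamma>1 t) (\<gamma>1 s)"
  have f: "(?f has_real_derivative ?f' s) (at s)" for s
    by (rule has_real_derivative_det2_right) (auto intro!: derivative_eq_intros deriv_\<gamma>)
  have "(?f' has_real_derivative det2 (\<gamma>1 t) (\<gamma>2 t)) (at t)"
    by (rule has_real_derivative_det2_right[OF deriv_\<gamma>1])
  from DERIV_neg_dec_right[OF this neg] obtain d where d: "d > 0" "\<And>h. 0 < h \<Longrightarrow> h < d \<Longrightarrow> ?f' (t + h) < 0"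
    by auto
  have "?f (t + d/2) < ?f t"
  proof (rule DERIV_neg_imp_decreasing_open[of t "t + d/2" ?f])
    fix x assume "t < x" "x < t + d/2"
    then show "\<exists>y. (?f has_real_derivative y) (at x) \<and> y < 0"
      using f[of x] d(2)[of "x - t"] by auto
  qed (use d(1) in \<open>auto intro!: continuous_intros det2.continuous_on continuous_on_\<gamma>\<close>)
  then show False using ccw[OF \<gamma>_in_K, of t "t + d/2"] by (simp add: det2.zero_right)
qed

section \<open>Chords, the arcs they separate, and caps as sectors\<close>

text \<open>The interior midpoint rules out segments lying in the boundary and serves as the centre
  of the sector that describes the cap.\<close>

definition chord :: "real \<Rightarrow> real \<Rightarrow> bool" where
  "chord t s \<longleftrightarrow> t < s \<and> s < t + L \<and> (1/2) *\<^sub>R (\<gamma> t + \<gamma> s) \<in> interior K"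

definition cap :: "real \<Rightarrow> real \<Rightarrow> (real^2) set" where
  "cap t s = K \<inter> {x. det2 (\<gamma> s - \<gamma> t) (x - \<gamma> t) \<le> 0}"

lemma chord_det_pos:
  assumes "chord t s"
  shows "0 < det2 (\<gamma>1 t) (\<gamma> s - \<gamma> t)" "0 < det2 (\<gamma> s - \<gamma> t) (\<gamma>1 s)"
proof -
  let ?m = "(1/2) *\<^sub>R (\<gamma> t + \<gamma> s)"
  have m: "?m \<in> interior K" using assms by (simp add: chord_def)
  have "det2 (\<gamma>1 t) (?m - \<gamma> t) = det2 (\<gamma>1 t) (\<gamma> s - \<gamma> t) / 2"
    "det2 (\<gamma>1 s) (?m - \<gamma> s) = det2 (\<gamma> s - \<gamma> t) (\<gamma>1 s) / 2"
    by (simp_all add: det2_def field_simps)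
  then show "0 < det2 (\<gamma>1 t) (\<gamma> s - \<gamma> t)" "0 < det2 (\<gamma> s - \<gamma> t) (\<gamma>1 s)"
    using interior_strict[OF m, of t] interior_strict[OF m, of s] by auto
qed

text \<open>The midpoint is interior, and each of the two opposite rays leaving it along the chord
  meets the frontier only once.\<close>

lemma chord_line_Int_frontier:
  assumes "chord t s" and z: "det2 (\<gamma> s - \<gamma> t) (\<gamma> \<tau> - \<gamma> t) = 0"
  shows "\<gamma> \<tau> = \<gamma> t \<or> \<gamma> \<tau> = \<gamma> s"
proof -
  let ?m = "(1/2) *\<^sub>R (\<gamma> t + \<gamma> s)" and ?v = "(1/2) *\<^sub>R (\<gamma> s - \<gamma> t)"
  have m: "?m \<in> interior K" using assms by (simp add: chord_def)
  have v: "\<gamma> s - \<gamma> t \<noteq> 0" using chord_det_pos[OF assms(1)] by (auto simp: det2.zero_left)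
  obtain c where "\<gamma> \<tau> - \<gamma> t = c *\<^sub>R (\<gamma> s - \<gamma> t)" using det2_eq_0_imp_scaleR[OF z v] by blast
  then have c: "\<gamma> \<tau> = ?m + (2 * c - 1) *\<^sub>R ?v"
    by (simp add: algebra_simps vec_eq_iff forall_2)
  have s: "\<gamma> s = ?m + 1 *\<^sub>R ?v" and t: "\<gamma> t = ?m + 1 *\<^sub>R (- ?v)"
    by (simp_all add: vec_eq_iff forall_2 field_simps)
  have c': "\<gamma> \<tau> = ?m + (1 - 2 * c) *\<^sub>R (- ?v)"
    using c by (simp add: vec_eq_iff forall_2 field_simps)
  consider "2 * c - 1 > 0" | "2 * c - 1 < 0" | "2 * c - 1 = 0" by linarith
  then show ?thesis
  proof cases
    case 1
    then have "2 * c - 1 = 1"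
      using \<gamma>_in_frontier[of \<tau>] \<gamma>_in_frontier[of s] c s by (intro frontier_ray_unique[OF m, of _ ?v]) auto
    then show ?thesis using c s by simp
  next
    case 2
    then have "1 - 2 * c = 1"
      using \<gamma>_in_frontier[of \<tau>] \<gamma>_in_frontier[of t] c' t by (intro frontier_ray_unique[OF m, of _ "- ?v"]) auto
    then show ?thesis using c' t by simp
  next
    case 3
    then show ?thesis using c m \<gamma>_notin_interior[of \<tau>] by simp
  qed
qed

text \<open>The curve leaves \<gamma> \<open>t\<close> to the right of the chord, by transversality.
  To return it would have to cross the line of the chord, which it meets only at the two end points,
  and neither is revisited strictly between \<open>t\<close> and \<open>s\<close>.\<close>

lemma chord_side_neg:
  assumes c: "chord t s" and "t < \<tau>" "\<tau> < s"
  shows "det2 (\<gamma> s - \<gamma> t) (\<gamma> \<tau> - \<gamma> t) < 0"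
proof (rule ccontr)
  assume n: "\<not> ?thesis"
  let ?f = "\<lambda>\<tau>. det2 (\<gamma> s - \<gamma> t) (\<gamma> \<tau> - \<gamma> t)"
  have d: "(?f has_real_derivative det2 (\<gamma> s - \<gamma> t) (\<gamma>1 t)) (at t)"
    by (rule has_real_derivative_det2_right) (auto intro!: derivative_eq_intros deriv_\<gamma>)
  have "det2 (\<gamma> s - \<gamma> t) (\<gamma>1 t) < 0" using chord_det_pos(1)[OF c] by (subst det2_swap) simp
  from DERIV_neg_dec_right[OF d this] obtain e
    where e: "e > 0" "\<And>h. 0 < h \<Longrightarrow> h < e \<Longrightarrow> ?f (t + h) < ?f t" by auto
  define h where "h = min (e/2) ((\<tau> - t)/2)"
  have h: "0 < h" "h < e" "t + h < \<tau>" using e(1) assms by (auto simp: h_def min_def field_simps)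
  have "?f (t + h) < 0" using e(2)[OF h(1,2)] by (simp add: det2.zero_right)
  moreover have "continuous_on {t+h..\<tau>} ?f"
    by (auto intro!: continuous_intros det2.continuous_on continuous_on_\<gamma>)
  ultimately obtain x where x: "t + h \<le> x" "x \<le> \<tau>" "?f x = 0"
    using IVT'[of ?f "t + h" 0 \<tau>] n h by auto
  from chord_line_Int_frontier[OF c x(3)] show False
  proof
    assume "\<gamma> x = \<gamma> t"
    then have "x = t" using x h assms c by (intro \<gamma>_inj) (auto simp: chord_def)
    then show False using x h by simp
  next
    assume "\<gamma> x = \<gamma> s"
    then have "s = x" using x h assms c by (intro \<gamma>_inj) (auto simp: chord_def)
    then show False using x assms by simp
  qed
qed

text \<open>The complementary arc belongs to the reversed chord from \<open>s\<close> to
  \<open>t + L\<close>, so the sign flips.\<close>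

lemma chord_side_pos:
  assumes c: "chord t s" and "s < \<tau>" "\<tau> < t + L"
  shows "0 < det2 (\<gamma> s - \<gamma> t) (\<gamma> \<tau> - \<gamma> t)"
proof -
  have "chord s (t + L)" using c by (auto simp: chord_def periodic add.commute[of "\<gamma> s"])
  from chord_side_neg[OF this assms(2,3)] show ?thesis
    by (simp only: periodic det2_def) (simp add: algebra_simps)
qed

text \<open>Prolong the segment from the midpoint through a point of the cap until it hits the
  frontier. The side of the chord is only scaled along this ray (\<open>det_m\<close>), so the exit
  point lies on the arc from \<open>t\<close> to \<open>s\<close>.\<close>

lemma cap_eq_sector:
  assumes c: "chord t s"
  defines "m \<equiv> (1/2) *\<^sub>R (\<gamma> t + \<gamma> s)"
  shows "cap t s = {m + r *\<^sub>R (\<gamma> \<tau> - m) | r \<tau>. 0 \<le> r \<and> r \<le> 1 \<and> t \<le> \<tau> \<and> \<tau> \<le> s}"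
proof -
  have m: "m \<in> interior K" using assms by (simp add: chord_def)
  have det_m: "det2 (\<gamma> s - \<gamma> t) (m + r *\<^sub>R (y - m) - \<gamma> t) = r * det2 (\<gamma> s - \<gamma> t) (y - \<gamma> t)" for r y
    by (simp add: m_def det2_def field_simps)
  have ts: "t < s" "s < t + L" using c by (auto simp: chord_def)
  show ?thesis
  proof (intro equalityI subsetI)
    fix x assume x: "x \<in> cap t s"
    show "x \<in> {m + r *\<^sub>R (\<gamma> \<tau> - m) | r \<tau>. 0 \<le> r \<and> r \<le> 1 \<and> t \<le> \<tau> \<and> \<tau> \<le> s}"
    proof (cases "x = m")
      case True
      then show ?thesis using ts by (intro CollectI exI[of _ 0] exI[of _ t]) auto
    next
      case False
      obtain e where e: "0 < e" "m + e *\<^sub>R (x - m) \<in> frontier K"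
          "\<And>e'. 0 \<le> e' \<Longrightarrow> e' < e \<Longrightarrow> m + e' *\<^sub>R (x - m) \<in> interior K"
        using ray_to_frontier[OF compact_imp_bounded[OF compact_K] m, of "x - m"] False by auto
      have "1 \<le> e"
      proof (rule ccontr)
        assume "\<not> 1 \<le> e"
        have xK: "x \<in> closure K" using x closure_subset by (auto simp: cap_def)
        have "m + e *\<^sub>R (x - m) = (1 - e) *\<^sub>R m + e *\<^sub>R x" by (simp add: algebra_simps)
        then have "m + e *\<^sub>R (x - m) \<in> open_segment m x"
          using \<open>\<not> 1 \<le> e\<close> e(1) False by (auto simp: in_segment)
        then have "m + e *\<^sub>R (x - m) \<in> interior K"
          using in_interior_closure_convex_segment[OF convex_K m xK] by auto
        then show False using e(2) by (auto simp: frontier_def)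
      qed
      obtain \<tau> where \<tau>: "t \<le> \<tau>" "\<tau> < t + L" "\<gamma> \<tau> = m + e *\<^sub>R (x - m)" using \<gamma>_surj[OF e(2)] by metis
      have x_eq: "x = m + (1/e) *\<^sub>R (\<gamma> \<tau> - m)" using e(1) \<tau>(3) by simp
      have "\<tau> \<le> s"
      proof (rule ccontr)
        assume "\<not> \<tau> \<le> s"
        then have "0 < det2 (\<gamma> s - \<gamma> t) (\<gamma> \<tau> - \<gamma> t)" using chord_side_pos[OF c, of \<tau>] \<tau>(2) by simp
        then have "0 < det2 (\<gamma> s - \<gamma> t) (x - \<gamma> t)"
          using det_m[of "1/e" "\<gamma> \<tau>"] x_eq e(1) by simp
        then show False using x by (simp add: cap_def)
      qed
      then show ?thesis using x_eq \<tau>(1) e(1) \<open>1 \<le> e\<close> by (intro CollectI exI[of _ "1/e"] exI[of _ \<tau>]) auto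
    qed
  next
    fix x assume "x \<in> {m + r *\<^sub>R (\<gamma> \<tau> - m) | r \<tau>. 0 \<le> r \<and> r \<le> 1 \<and> t \<le> \<tau> \<and> \<tau> \<le> s}"
    then obtain r \<tau> where r: "x = m + r *\<^sub>R (\<gamma> \<tau> - m)" "0 \<le> r" "r \<le> 1" "t \<le> \<tau>" "\<tau> \<le> s" by auto
    have "x = (1 - r) *\<^sub>R m + r *\<^sub>R \<gamma> \<tau>" using r by (simp add: algebra_simps)
    then have "x \<in> K"
      using r convexD[OF convex_K, of m "\<gamma> \<tau>" "1 - r" r] m interior_subset \<gamma>_in_K by auto
    moreover have "det2 (\<gamma> s - \<gamma> t) (\<gamma> \<tau> - \<gamma> t) \<le> 0"
      using chord_side_neg[OF c, of \<tau>] r by (cases "\<tau> = t \<or> \<tau> = s") (auto simp: det2.zero_right)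
    then have "det2 (\<gamma> s - \<gamma> t) (x - \<gamma> t) \<le> 0"
      using det_m[of r "\<gamma> \<tau>"] r by (simp add: mult_nonneg_nonpos)
    ultimately show "x \<in> cap t s" by (simp add: cap_def)
  qed
qed

end

section \<open>Area of a cap and existence of chords cutting off a given area\<close>

context ccw_body begin

text \<open>Twice the area swept by the position vector, as in Green's formula.\<close>

definition G :: "real \<Rightarrow> real" where
  "G = primitive (\<lambda>t. det2 (\<gamma> t) (\<gamma>1 t))"

lemma deriv_G: "(G has_real_derivative det2 (\<gamma> t) (\<gamma>1 t)) (at t)"
  unfolding G_def
  by (rule has_real_derivative_primitive) (intro det2.continuous_on continuous_on_\<gamma> continuous_on_\<gamma>1)

text \<open>The cap is the sector swept from the midpoint \<open>m\<close> of the chord. Parametrising it by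
  \<open>(w, y) \<mapsto> m + sqrt w (\<gamma> (Z y) - m)\<close>, where \<open>Z\<close> inverts the swept-area function
  \<open>Y\<close>, makes the Jacobian equal to \<open>1\<close>, so no iterated integral is needed.\<close>

lemma measure_cap:
  assumes c: "chord t s"
  shows "measure lebesgue (cap t s) = (G s - G t - det2 (\<gamma> t) (\<gamma> s)) / 2"
proof -
  define m where "m = (1/2) *\<^sub>R (\<gamma> t + \<gamma> s)"
  have m: "m \<in> interior K" and ts: "t < s" "s < t + L" using c by (auto simp: chord_def m_def)
  \<comment> \<open>The same swept area, now seen from \<open>m\<close> instead of the origin. It is
    strictly increasing because \<open>m\<close> is interior, hence strictly left of every
    tangent.\<close>
  define Y where "Y \<tau> = (G \<tau> - det2 m (\<gamma> \<tau>)) / 2" for \<tau>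
  define Y' where "Y' \<tau> = det2 (\<gamma> \<tau> - m) (\<gamma>1 \<tau>) / 2" for \<tau>
  have dY: "(Y has_real_derivative Y' \<tau>) (at \<tau>)" for \<tau>
    unfolding Y_def Y'_def det2.diff_left
    by (intro DERIV_cdivide DERIV_diff deriv_G has_real_derivative_det2_right deriv_\<gamma>)
  have Y'_pos: "0 < Y' \<tau>" for \<tau>
    using interior_strict[OF m, of \<tau>] by (simp add: Y'_def det2_def algebra_simps)
  have Y_less: "Y a < Y b" if "a < b" for a b
    by (rule DERIV_pos_imp_increasing[OF that]) (use dY Y'_pos in metis)
  then have Y_less_iff: "Y a < Y b \<longleftrightarrow> a < b" for a b
    by (metis linorder_less_linear order_less_asym)
  then have inj_Y: "inj Y" by (intro injI) (metis linorder_less_linear order_less_irrefl)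
  define Z where "Z = inv Y"
  have ZY: "Z (Y \<tau>) = \<tau>" for \<tau> using inj_Y by (simp add: Z_def)
  have contY: "isCont Y \<tau>" for \<tau> using dY DERIV_isCont by blast
  have Z: "Y (Z y) = y \<and> t < Z y \<and> Z y < s" if y: "Y t < y" "y < Y s" for y
  proof -
    obtain \<tau> where "t \<le> \<tau>" "\<tau> \<le> s" "Y \<tau> = y"
      using IVT[of Y t y s] y contY ts by auto
    then show ?thesis using y ZY by (metis order_le_less order_less_irrefl)
  qed
  have dZ: "(Z has_real_derivative 1 / Y' (Z y)) (at y)" if "Y t < y" "y < Y s" for y
  proof -
    have "isCont Z (Y (Z y))"
      by (rule isCont_inverse_function2[of t "Z y" s]) (use Z[OF that] in \<open>simp_all only: ZY contY\<close>)
    then have "isCont Z y" using Z[OF that] by simp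
    then show ?thesis
      using DERIV_inverse_function[OF dY _ that, of Z] Z Y'_pos[of "Z y"] by (simp add: inverse_eq_divide)
  qed
  define S where "S = box (vector [0, Y t]) (vector [1, Y s] :: real^2)"
  have S_iff: "x \<in> S \<longleftrightarrow> 0 < x$1 \<and> x$1 < 1 \<and> Y t < x$2 \<and> x$2 < Y s" for x
    by (auto simp: S_def mem_box_cart forall_2)
  define f where "f x = m + sqrt (x$1) *\<^sub>R (\<gamma> (Z (x$2)) - m)" for x :: "real^2"
  define f' where "f' x h = (h$1 * (inverse (sqrt (x$1)) / 2)) *\<^sub>R (\<gamma> (Z (x$2)) - m)
      + sqrt (x$1) *\<^sub>R (h$2 *\<^sub>R ((1 / Y' (Z (x$2))) *\<^sub>R \<gamma>1 (Z (x$2))))" for x h :: "real^2"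
  have df: "(f has_derivative f' x) (at x within S)" if "x \<in> S" for x
  proof -
    have x: "0 < x$1" "Y t < x$2" "x$2 < Y s" using that S_iff by auto
    have comp: "((\<lambda>x::real^2. x$i) has_derivative (\<lambda>h. h$i)) (at x within S)" for i
      by (rule bounded_linear_imp_has_derivative[OF bounded_linear_vec_nth])
    have s: "((\<lambda>x. sqrt (x$1)) has_derivative (\<lambda>h. h$1 * (inverse (sqrt (x$1)) / 2))) (at x within S)"
      by (rule DERIV_compose_FDERIV[OF DERIV_real_sqrt[OF x(1)] comp])
    have "((\<lambda>y. \<gamma> (Z y)) has_vector_derivative (1 / Y' (Z (x$2))) *\<^sub>R \<gamma>1 (Z (x$2))) (at (x$2))"
      by (rule has_vector_derivative_compose_real[OF deriv_\<gamma> dZ[OF x(2,3)]])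
    then have "((\<lambda>y. \<gamma> (Z y)) has_derivative (\<lambda>h. h *\<^sub>R ((1 / Y' (Z (x$2))) *\<^sub>R \<gamma>1 (Z (x$2))))) (at (x$2))"
      by (simp add: has_vector_derivative_def)
    then have g: "((\<lambda>x. \<gamma> (Z (x$2))) has_derivative (\<lambda>h. h$2 *\<^sub>R ((1 / Y' (Z (x$2))) *\<^sub>R \<gamma>1 (Z (x$2))))) (at x within S)"
      by (rule has_derivative_compose[OF comp])
    show ?thesis
      unfolding f_def f'_def
      by (rule derivative_eq_intros s g refl)+ (simp add: fun_eq_iff add.commute)
  qed
  have jac: "\<bar>det (matrix (f' x))\<bar> = 1" if "x \<in> S" for x
  proof -
    have x: "0 < sqrt (x$1)" using that S_iff by auto
    have "det (matrix (f' x)) = det2 (f' x (axis 1 1)) (f' x (axis 2 1))"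
      by (simp add: det_2 matrix_def det2_def)
    also have "\<dots> = (inverse (sqrt (x$1)) * sqrt (x$1)) * (Y' (Z (x$2)) * (1 / Y' (Z (x$2))))"
      by (simp add: f'_def axis_def det2.scaleR_left det2.scaleR_right) (simp add: Y'_def)
    also have "\<dots> = 1" using x Y'_pos[of "Z (x$2)"] by simp
    finally show ?thesis by simp
  qed
  have inj_f: "inj_on f S"
  proof (rule inj_onI)
    fix x y assume x: "x \<in> S" and y: "y \<in> S" and eq: "f x = f y"
    let ?a = "Z (x$2)" and ?b = "Z (y$2)" and ?d = "\<gamma> (Z (x$2)) - m"
    have pos: "0 < sqrt (x$1)" "0 < sqrt (y$1)" using x y S_iff by auto
    have a: "Y ?a = x$2" "t < ?a" "?a < s" and b: "Y ?b = y$2" "t < ?b" "?b < s"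
      using Z x y S_iff by auto
    have "sqrt (y$1) *\<^sub>R (\<gamma> ?b - m) = sqrt (x$1) *\<^sub>R ?d" using eq by (simp add: f_def)
    then have "(1 / sqrt (y$1)) *\<^sub>R (sqrt (y$1) *\<^sub>R (\<gamma> ?b - m)) = (1 / sqrt (y$1)) *\<^sub>R (sqrt (x$1) *\<^sub>R ?d)"
      by simp
    then have b_eq: "\<gamma> ?b = m + (sqrt (x$1) / sqrt (y$1)) *\<^sub>R ?d" using pos by (simp add: algebra_simps)
    have "sqrt (x$1) / sqrt (y$1) = 1"
    proof (rule frontier_ray_unique[OF m])
      show "m + (sqrt (x$1) / sqrt (y$1)) *\<^sub>R ?d \<in> frontier K" using \<gamma>_in_frontier[of ?b] b_eq by simp
      show "m + 1 *\<^sub>R ?d \<in> frontier K" using \<gamma>_in_frontier[of ?a] by simp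
    qed (use pos in auto)
    then have "\<gamma> ?a = \<gamma> ?b" "sqrt (x$1) = sqrt (y$1)" using b_eq pos by auto
    moreover have "?a = ?b"
    proof (cases "?a \<le> ?b")
      case True
      then have "?b = ?a" using calculation(1) a(2) b(3) ts(2) by (intro \<gamma>_inj) auto
      then show ?thesis ..
    next
      case False
      then show ?thesis using calculation(1) b(2) a(3) ts(2) by (intro \<gamma>_inj) auto
    qed
    then have "x$2 = y$2" using a(1) b(1) by metis
    moreover have "x$1 = y$1" using calculation(2) by simp
    ultimately show "x = y" by (simp add: vec_eq_iff forall_2)
  qed
  have S_lm: "S \<in> lmeasurable" by (simp add: S_def)
  have "measure lebesgue (f ` S) = integral S (\<lambda>x. \<bar>det (matrix (f' x))\<bar>)"
  proof (rule measure_differentiable_image_eq[OF _ df inj_f])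
    show "S \<in> sets lebesgue" using S_lm by blast
    have "(\<lambda>x. 1::real) integrable_on S" using S_lm by (simp add: integrable_on_const)
    then show "(\<lambda>x. \<bar>det (matrix (f' x))\<bar>) integrable_on S"
      by (rule integrable_eq) (simp add: jac)
  qed
  also have "\<dots> = integral S (\<lambda>x. 1)" by (rule integral_cong) (simp add: jac)
  also have "\<dots> = measure lebesgue S" by (rule lmeasure_integral[OF S_lm, symmetric])
  also have "\<dots> = measure lborel (cbox (vector [0, Y t]) (vector [1, Y s] :: real^2))"
    by (simp add: S_def measure_lborel_box_eq measure_lborel_cbox_eq)
  also have "\<dots> = Y s - Y t"
    using Y_less[OF ts(1)]
    by (subst content_cbox_cart) (auto simp: interval_ne_empty_cart UNIV_2 forall_2)
  also have "\<dots> = (G s - G t - det2 (\<gamma> t) (\<gamma> s)) / 2"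
    by (simp add: Y_def m_def det2_def field_simps)
  finally have meas: "measure lebesgue (f ` S) = (G s - G t - det2 (\<gamma> t) (\<gamma> s)) / 2" .
  have v: "\<gamma> s - \<gamma> t \<noteq> 0" using chord_det_pos[OF c] by (auto simp: det2.zero_left)
  have sub: "f ` S \<subseteq> cap t s"
  proof
    fix x assume "x \<in> f ` S"
    then obtain y where y: "x = f y" "y \<in> S" by blast
    then show "x \<in> cap t s"
      unfolding cap_eq_sector[OF c] m_def[symmetric] using Z[of "y$2"] S_iff[of y]
      by (intro CollectI exI[of _ "sqrt (y$1)"] exI[of _ "Z (y$2)"]) (auto simp: f_def)
  qed
  \<comment> \<open>\<open>S\<close> is an open box, so its image misses exactly the degenerate part
    of the sector: the centre and the two end rays, which lie on the chord, and the arc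
    itself.\<close>
  have "cap t s - f ` S \<subseteq> frontier K \<union> {x. det2 (\<gamma> s - \<gamma> t) (x - \<gamma> t) = 0}"
  proof
    fix x assume x: "x \<in> cap t s - f ` S"
    then obtain r \<tau> where r: "x = m + r *\<^sub>R (\<gamma> \<tau> - m)" "0 \<le> r" "r \<le> 1" "t \<le> \<tau>" "\<tau> \<le> s"
      unfolding cap_eq_sector[OF c] m_def[symmetric] by auto
    consider "r = 0 \<or> \<tau> = t \<or> \<tau> = s" | "r = 1" | "0 < r" "r < 1" "t < \<tau>" "\<tau> < s"
      using r by linarith
    then show "x \<in> frontier K \<union> {x. det2 (\<gamma> s - \<gamma> t) (x - \<gamma> t) = 0}"
    proof cases
      case 1
      then have "det2 (\<gamma> s - \<gamma> t) (x - \<gamma> t) = 0"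
        unfolding r(1) by (elim disjE) (simp_all add: m_def det2_def field_simps)
      then show ?thesis by simp
    next
      case 2
      then show ?thesis using r(1) \<gamma>_in_frontier[of \<tau>] by simp
    next
      case 3
      let ?y = "vector [r^2, Y \<tau>] :: real^2"
      have "?y \<in> S" using 3 Y_less_iff by (auto simp: S_iff power_less_one_iff)
      moreover have "f ?y = x" using 3 r(1) by (simp add: f_def ZY)
      ultimately show ?thesis using x by blast
    qed
  qed
  moreover have "negligible (frontier K \<union> {x. det2 (\<gamma> s - \<gamma> t) (x - \<gamma> t) = 0})"
    using negligible_convex_frontier[OF convex_K] negligible_det2_line[OF v] by simp
  ultimately have "negligible (cap t s - f ` S)" by (rule negligible_subset[rotated])
  moreover have "f ` S - cap t s = {}" using sub by blast
  moreover have "compact (cap t s)"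
    unfolding cap_def
    by (intro compact_Int_closed[OF compact_K] closed_Collect_le continuous_intros det2.continuous_on)
  then have "cap t s \<in> lmeasurable" by (rule lmeasurable_compact)
  ultimately have "measure lebesgue (f ` S) = measure lebesgue (cap t s)"
    by (intro measure_negligible_symdiff) auto
  then show ?thesis using meas by simp
qed

text \<open>Rotate a line about \<gamma> \<open>t\<close> from the tangent to the reversed tangent:
  the area to its right grows continuously from zero to the whole, so the value \<delta> occurs by
  the intermediate value theorem.\<close>

lemma exists_chord:
  assumes "0 < \<delta>" "\<delta> < measure lebesgue K"
  shows "\<exists>s. chord t s \<and> measure lebesgue (cap t s) = \<delta>"
proof -
  let ?e = "\<gamma>1 t" and ?p = "\<gamma> t"
  \<comment> \<open>A polynomial half turn: \<open>d (-1)\<close> is the tangent vector,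
    \<open>d 0\<close> the inward normal, \<open>d 1\<close> the reversed tangent, and for
    \<open>w\<close> strictly between the ends the direction points inwards.\<close>
  define d where "d w = (- w) *\<^sub>R ?e + (1 - w\<^sup>2) *\<^sub>R rot ?e" for w :: real
  have ee: "?e \<bullet> ?e > 0" using regular[of t] by simp
  have rot0: "?e \<bullet> rot ?e = 0" by (metis det2_eq_inner_rot det2_self inner_commute)
  have nz: "d w \<noteq> 0" for w
  proof
    assume 0: "d w = 0"
    have "?e \<bullet> d w = - w * (?e \<bullet> ?e)" by (simp add: d_def inner_add_right inner_diff_right rot0)
    then have "w = 0" using 0 ee by simp
    then show False using 0 regular[of t] by (simp add: d_def)
  qed
  define \<mu> where "\<mu> w = measure lebesgue (K \<inter> {x. det2 (d w) (x - ?p) \<le> 0})" for w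
  have cont: "continuous_on UNIV \<mu>"
    unfolding \<mu>_def
    by (rule continuous_measure_cut[OF compact_K _ nz]) (auto simp: d_def intro!: continuous_intros)
  have null: "measure lebesgue S = 0" if "negligible S" for S :: "(real^2) set"
    using that by (simp add: negligible_imp_measure0)
  have m1: "\<mu> (-1) = 0"
  proof -
    have "K \<inter> {x. det2 (d (-1)) (x - ?p) \<le> 0} \<subseteq> {x. det2 (d (-1)) (x - ?p) = 0}"
      using ccw[of _ t] by (force simp: d_def)
    then have "negligible (K \<inter> {x. det2 (d (-1)) (x - ?p) \<le> 0})"
      using negligible_det2_line[OF nz] negligible_subset by blast
    then show ?thesis unfolding \<mu>_def by (rule null)
  qed
  have m2: "\<mu> 1 = measure lebesgue K"
  proof -
    have "K \<inter> {x. det2 (d 1) (x - ?p) \<le> 0} = K"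
      using ccw[of _ t] by (auto simp: d_def det2.minus_left)
    then show ?thesis by (simp add: \<mu>_def)
  qed
  obtain w where w: "-1 \<le> w" "w \<le> 1" "\<mu> w = \<delta>"
    using IVT'[of \<mu> "-1" \<delta> 1] m1 m2 assms continuous_on_subset[OF cont] by auto
  then have "w \<noteq> -1" "w \<noteq> 1" using m1 m2 assms by auto
  then have "w\<^sup>2 < 1" using w by (simp add: abs_square_less_1)
  then have ed: "0 < det2 ?e (d w)"
    using ee by (simp add: d_def det2.diff_right det2.scaleR_right det2_rot)
  let ?f = "\<lambda>x. det2 (d w) (x - ?p)"
  have fr: "K - interior K \<subseteq> frontier K" using closure_subset by (auto simp: frontier_def)
  \<comment> \<open>If the interior lay on one side of the line, the area cut off would be zero or
    full. Interior points on both sides yield one on the line, by the convex combination with weight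
    \<open>u\<close> at which the affine function \<open>?f\<close> vanishes.\<close>
  have "\<exists>z\<in>interior K. ?f z = 0"
  proof (rule ccontr)
    assume no: "\<not> ?thesis"
    have neg: "negligible (K - interior K)"
      using negligible_convex_frontier[OF convex_K] fr negligible_subset by blast
    have "\<exists>a\<in>interior K. ?f a < 0"
    proof (rule ccontr)
      assume "\<not> ?thesis"
      then have "K \<inter> {x. ?f x \<le> 0} \<subseteq> K - interior K" using no by force
      then have "\<mu> w = 0" unfolding \<mu>_def by (intro null negligible_subset[OF neg])
      then show False using w assms by simp
    qed
    moreover have "\<exists>a\<in>interior K. ?f a > 0"
    proof (rule ccontr)
      assume "\<not> ?thesis"
      then have "K - K \<inter> {x. ?f x \<le> 0} \<subseteq> K - interior K" using no by force
      then have "negligible (K - K \<inter> {x. ?f x \<le> 0})" by (rule negligible_subset[OF neg])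
      moreover have "K \<inter> {x. ?f x \<le> 0} - K = {}" by blast
      ultimately have "measure lebesgue (K \<inter> {x. ?f x \<le> 0}) = measure lebesgue K"
        using lmeasurable_compact[OF compact_K] by (intro measure_negligible_symdiff) auto
      then show False using w assms by (simp add: \<mu>_def)
    qed
    ultimately obtain a b where ab: "a \<in> interior K" "b \<in> interior K" "?f a < 0" "?f b > 0" by blast
    define u where "u = ?f b / (?f b - ?f a)"
    let ?z = "u *\<^sub>R a + (1 - u) *\<^sub>R b"
    have "0 \<le> u" using ab by (simp add: u_def)
    moreover have "u \<le> 1" using ab by (simp add: u_def)
    ultimately have "?z \<in> interior K"
      using ab by (intro convexD[OF convex_interior[OF convex_K]]) auto
    moreover have "?f ?z = u * ?f a + (1 - u) * ?f b"
      by (simp add: det2_def algebra_simps)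
    moreover have "u * (?f b - ?f a) = ?f b" using ab by (simp add: u_def)
    then have "u * ?f a + (1 - u) * ?f b = 0" by (simp add: algebra_simps)
    ultimately show False using no by metis
  qed
  then obtain z where z: "z \<in> interior K" "?f z = 0" by blast
  obtain c where c: "z - ?p = c *\<^sub>R d w" using det2_eq_0_imp_scaleR[OF z(2) nz] by blast
  have "0 < det2 ?e (z - ?p)" by (rule interior_strict[OF z(1)])
  then have c_pos: "0 < c" using ed unfolding c by (simp add: det2.scaleR_right zero_less_mult_iff)
  obtain r where r: "0 < r" "z + r *\<^sub>R d w \<in> frontier K"
    using ray_to_frontier[OF compact_imp_bounded[OF compact_K] z(1) nz] by metis
  obtain s where s: "t \<le> s" "s < t + L" "\<gamma> s = z + r *\<^sub>R d w" using \<gamma>_surj[OF r(2)] by metis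
  have v: "\<gamma> s - ?p = (c + r) *\<^sub>R d w" using c s by (simp add: algebra_simps)
  have "s \<noteq> t" using v c_pos r nz[of w] by auto
  let ?m = "(1/2) *\<^sub>R (?p + \<gamma> s)"
  have m1: "?m = z + ((r - c)/2) *\<^sub>R d w" and m2: "?m = z + ((c - r)/2) *\<^sub>R (- d w)"
    and p: "?p = z + c *\<^sub>R (- d w)"
    using c s(3) by (auto simp: vec_eq_iff forall_2 field_simps)
  \<comment> \<open>Seen from \<open>z\<close>, a midpoint on the frontier would be a second
    frontier point on the ray to one of the end points, which \<open>frontier_ray_unique\<close>
    forbids.\<close>
  have "?m \<in> interior K"
  proof (rule ccontr)
    assume "?m \<notin> interior K"
    moreover have "?m \<in> K" using convexD[OF convex_K \<gamma>_in_K \<gamma>_in_K, of "1/2" "1/2" t s] by (simp add: algebra_simps)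
    ultimately have m: "?m \<in> frontier K" using fr by blast
    consider "r > c" | "r < c" | "r = c" by linarith
    then show False
    proof cases
      case 1
      then have "(r - c)/2 = r" using m m1 r by (intro frontier_ray_unique[OF z(1), of _ "d w"]) auto
      then show False using c_pos r by simp
    next
      case 2
      then have "(c - r)/2 = c" using m m2 p c_pos \<gamma>_in_frontier[of t]
        by (intro frontier_ray_unique[OF z(1), of _ "- d w"]) auto
      then show False using c_pos r by simp
    next
      case 3
      then show False using m m1 z by (simp add: frontier_def)
    qed
  qed
  then have "chord t s" using s \<open>s \<noteq> t\<close> by (simp add: chord_def)
  moreover have "cap t s = K \<inter> {x. ?f x \<le> 0}"
    unfolding cap_def v using c_pos r by (auto simp: det2.scaleR_left mult_le_0_iff)
  ultimately show ?thesis using w(3) by (auto simp: \<mu>_def)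
qed

end

text \<open>Caratheodory's form of the derivative, with a quotient that is continuous at the point.
  It allows implicit differentiation in \<open>deriv_F\<close> by exact identities instead of error
  estimates.\<close>

lemma vector_caratheodory:
  fixes f :: "real \<Rightarrow> real^2"
  assumes "(f has_vector_derivative D) (at x)"
  obtains g where "\<And>z. f z - f x = (z - x) *\<^sub>R g z" "isCont g x" "g x = D"
proof -
  have "((\<lambda>z. f z $ i) has_real_derivative D $ i) (at x)" for i
    using bounded_linear.has_vector_derivative[OF bounded_linear_vec_nth assms, of i]
    by (simp add: has_real_derivative_iff_has_vector_derivative)
  then have "\<exists>g. (\<forall>z. f z $ i - f x $ i = g z * (z - x)) \<and> isCont g x \<and> g x = D $ i" for i
    unfolding CARAT_DERIV .
  then obtain g where g: "\<And>i z. f z $ i - f x $ i = g i z * (z - x)" "\<And>i. isCont (g i) x" "\<And>i. g i x = D $ i"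
    by metis
  show thesis
  proof (rule that[of "\<lambda>z. \<chi> i. g i z"])
    show "isCont (\<lambda>z. \<chi> i. g i z) x"
      using g(2) unfolding isCont_def by (intro vec_tendstoI) simp
  qed (use g in \<open>auto simp: vec_eq_iff mult.commute\<close>)
qed

section \<open>Area and affine arc length as functions of the parameters\<close>

context ccw_body begin

text \<open>The value of \<open>measure_cap\<close>, kept for arbitrary parameters so that
  monotonicity and limits are available for pairs not known to form a chord.\<close>

definition area :: "real \<Rightarrow> real \<Rightarrow> real" where
  "area t s = (G s - G t - det2 (\<gamma> t) (\<gamma> s)) / 2"

lemma deriv_area: "(area t has_real_derivative det2 (\<gamma> s - \<gamma> t) (\<gamma>1 s) / 2) (at s)"
proof -
  have "((\<lambda>s. (G s - G t - det2 (\<gamma> t) (\<gamma> s)) / 2) has_real_derivative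
      (det2 (\<gamma> s) (\<gamma>1 s) - 0 - det2 (\<gamma> t) (\<gamma>1 s)) / 2) (at s)"
    by (intro DERIV_cdivide DERIV_diff DERIV_const deriv_G has_real_derivative_det2_right deriv_\<gamma>)
  then show ?thesis unfolding area_def det2.diff_left by simp
qed

lemma area_mono:
  assumes "s \<le> s'"
  shows "area t s \<le> area t s'"
proof (rule DERIV_nonneg_imp_nondecreasing[OF assms])
  fix x
  have "0 \<le> det2 (\<gamma> x - \<gamma> t) (\<gamma>1 x) / 2"
    using ccw[OF \<gamma>_in_K, of x t] by (simp add: det2_def algebra_simps)
  then show "\<exists>y. (area t has_real_derivative y) (at x) \<and> 0 \<le> y" using deriv_area by blast
qed

text \<open>The derivative is positive at the end of a chord, which gives strictness close to
  \<open>s\<close>; beyond that, weak monotonicity is enough.\<close>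

lemma area_strict_mono:
  assumes "chord t s"
  shows "s < s' \<Longrightarrow> area t s < area t s'" "s' < s \<Longrightarrow> area t s' < area t s"
proof -
  have pos: "0 < det2 (\<gamma> s - \<gamma> t) (\<gamma>1 s) / 2" using chord_det_pos(2)[OF assms] by simp
  show "area t s < area t s'" if "s < s'"
  proof -
    obtain d where d: "d > 0" "\<And>h. 0 < h \<Longrightarrow> h < d \<Longrightarrow> area t s < area t (s + h)"
      using DERIV_pos_inc_right[OF deriv_area pos] by auto
    define h where "h = min (d/2) (s' - s)"
    have "0 < h" "h < d" "s + h \<le> s'" using d(1) that by (auto simp: h_def min_def)
    then show ?thesis using d(2)[of h] area_mono[of "s + h" s' t] by simp
  qed
  show "area t s' < area t s" if "s' < s"
  proof -
    obtain d where d: "d > 0" "\<And>h. 0 < h \<Longrightarrow> h < d \<Longrightarrow> area t (s - h) < area t s"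
      using DERIV_pos_inc_left[OF deriv_area pos] by auto
    define h where "h = min (d/2) (s - s')"
    have "0 < h" "h < d" "s' \<le> s - h" using d(1) that by (auto simp: h_def min_def)
    then show ?thesis using d(2)[of h] area_mono[of s' "s - h" t] by simp
  qed
qed

definition curv :: "real \<Rightarrow> real" where
  "curv t = det2 (\<gamma>1 t) (\<gamma>2 t)"

text \<open>Affine arc length counted along the boundary over all periods. Since \<open>curv\<close>
  may vanish on segments, strict monotonicity is a theorem (\<open>\<sigma>_strict_mono\<close>)
  that depends on the flotation hypothesis.\<close>

definition \<sigma> :: "real \<Rightarrow> real" where
  "\<sigma> = primitive (\<lambda>t. root 3 (curv t))"

lemma continuous_on_curv: "continuous_on S curv"
  unfolding curv_def
  by (intro det2.continuous_on continuous_on_\<gamma>1 continuous_on_subset[OF cont_\<gamma>2]) auto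

lemma deriv_\<sigma>: "(\<sigma> has_real_derivative root 3 (curv t)) (at t)"
  unfolding \<sigma>_def
  by (rule has_real_derivative_primitive) (intro continuous_intros continuous_on_curv)

lemma \<sigma>_mono: "s \<le> t \<Longrightarrow> \<sigma> s \<le> \<sigma> t"
  by (rule DERIV_nonneg_imp_nondecreasing[of s t])
    (use deriv_\<sigma> curvature_nonneg in \<open>auto simp: curv_def intro!: exI\<close>)

lemma \<sigma>_shift: "\<sigma> (t + L) = \<sigma> t + (\<sigma> L - \<sigma> 0)"
proof -
  have "((\<lambda>s. \<sigma> (s + L) - \<sigma> s) has_real_derivative 0) (at s)" for s
    using DERIV_chain2[OF deriv_\<sigma> DERIV_add_const_id, of L s UNIV] deriv_\<sigma>[of s]
    by (auto intro!: derivative_eq_intros simp: curv_def periodic_\<gamma>1 periodic_\<gamma>2)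
  then have "\<sigma> (t + L) - \<sigma> t = \<sigma> (0 + L) - \<sigma> 0"
    using DERIV_isconst_all by blast
  then show ?thesis by simp
qed

end

subsection \<open>The map sending one end of a chord of flotation to the other\<close>

locale equiaffine_flotation = ccw_body +
  fixes \<delta> :: real
  assumes \<delta>_pos: "0 < \<delta>" and \<delta>_less: "\<delta> < measure lebesgue K"
    and third: "\<And>t s. chord t s \<Longrightarrow> measure lebesgue (cap t s) = \<delta> \<Longrightarrow> \<sigma> s - \<sigma> t = (\<sigma> L - \<sigma> 0) / 3"
begin

definition F :: "real \<Rightarrow> real" where
  "F t = (SOME s. chord t s \<and> measure lebesgue (cap t s) = \<delta>)"

lemma F: "chord t (F t)" "measure lebesgue (cap t (F t)) = \<delta>"
  using someI_ex[OF exists_chord[OF \<delta>_pos \<delta>_less, of t]] by (auto simp: F_def)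

lemma area_F: "area t (F t) = \<delta>"
  using measure_cap[OF F(1)[of t]] F(2)[of t] by (simp add: area_def)

lemma \<sigma>_F: "\<sigma> (F t) = \<sigma> t + (\<sigma> L - \<sigma> 0) / 3"
  using third[OF F(1,2)[of t]] by linarith

text \<open>At \<open>F t - e\<close> and \<open>F t + e\<close> the area lies strictly below and
  above \<delta>. Both inequalities persist for nearby \<open>t'\<close>, and monotonicity then
  traps \<open>F t'\<close> between the two.\<close>

lemma isCont_F: "isCont F t"
  unfolding isCont_def
proof (rule tendstoI)
  fix e :: real assume e: "0 < e"
  have cont: "((\<lambda>t'. area t' s) \<longlongrightarrow> area t s) (at t)" for s
    unfolding area_def
    using isCont_\<gamma>[of t] DERIV_isCont[OF deriv_G[of t]]
    by (intro tendsto_intros det2.tendsto) (auto simp: isCont_def)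
  have "area t (F t - e) < \<delta>" "\<delta> < area t (F t + e)"
    using area_strict_mono[OF F(1)[of t]] area_F[of t] e by auto
  then have "\<forall>\<^sub>F t' in at t. area t' (F t - e) < \<delta>" "\<forall>\<^sub>F t' in at t. \<delta> < area t' (F t + e)"
    using order_tendstoD[OF cont] by blast+
  then show "\<forall>\<^sub>F t' in at t. dist (F t') (F t) < e"
  proof eventually_elim
    case (elim t')
    have "F t - e < F t'" "F t' < F t + e"
      using area_mono[of "F t'" "F t - e" t'] area_mono[of "F t + e" "F t'" t'] elim area_F[of t']
      by force+
    then show ?case by (simp add: dist_real_def abs_less_iff)
  qed
qed

definition v :: "real \<Rightarrow> real^2" where
  "v t = \<gamma> (F t) - \<gamma> t"

text \<open>Implicit differentiation of \<open>area t (F t) = \<delta>\<close>: minus the quotient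
  of the two partial derivatives. It says that the sum of the two end point velocities is parallel
  to the chord.\<close>

definition F' :: "real \<Rightarrow> real" where
  "F' t = det2 (\<gamma>1 t) (v t) / det2 (v t) (\<gamma>1 (F t))"

lemma v_det_pos: "0 < det2 (\<gamma>1 t) (v t)" "0 < det2 (v t) (\<gamma>1 (F t))"
  using chord_det_pos[OF F(1)] by (auto simp: v_def)

lemma F'_pos: "0 < F' t"
  using v_det_pos by (simp add: F'_def)

lemma v_nonzero: "v t \<noteq> 0"
  using v_det_pos(1)[of t] by (auto simp: det2.zero_right)

lemma deriv_F: "(F has_real_derivative F' t) (at t)"
proof -
  obtain g where g: "\<And>z. \<gamma> z - \<gamma> t = (z - t) *\<^sub>R g z" "isCont g t" "g t = \<gamma>1 t"
    using vector_caratheodory[OF deriv_\<gamma>[of t]] by metis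
  obtain k where k: "\<And>z. G z - G t = k z * (z - t)" "isCont k t" "k t = det2 (\<gamma> t) (\<gamma>1 t)"
    using deriv_G[of t] unfolding CARAT_DERIV by metis
  obtain a where a: "\<And>s. area t s - area t (F t) = a s * (s - F t)" "isCont a (F t)"
      "a (F t) = det2 (v t) (\<gamma>1 (F t)) / 2"
    using deriv_area[of t "F t"] unfolding CARAT_DERIV v_def by metis
  define Q where "Q z = (k z + det2 (g z) (\<gamma> (F z))) / 2" for z
  have contQ: "isCont Q t"
    unfolding Q_def by (intro isCont_divide isCont_add continuous_const det2.isCont k g isCont_o2[OF isCont_F isCont_\<gamma>]) simp
  have contA: "isCont (\<lambda>z. a (F z)) t" by (rule isCont_o2[OF isCont_F a(2)])
  \<comment> \<open>Both \<open>area t (F t)\<close> and \<open>area z (F z)\<close> equal \<delta>,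
    so the change caused by moving the far end is cancelled exactly by that of moving the near
    end.\<close>
  have key: "a (F z) * (F z - F t) = Q z * (z - t)" for z
  proof -
    have "a (F z) * (F z - F t) = area t (F z) - area z (F z)" using a(1)[of "F z"] area_F[of z] area_F[of t] by simp
    also have "\<dots> = ((G z - G t) + det2 (\<gamma> z - \<gamma> t) (\<gamma> (F z))) / 2"
      by (simp add: area_def det2.diff_left field_simps)
    also have "\<dots> = Q z * (z - t)"
      unfolding g(1) k(1) Q_def det2.scaleR_left by (simp add: field_simps)
    finally show ?thesis .
  qed
  have pos: "0 < a (F t)" using a(3) v_det_pos(2)[of t] by simp
  have "((\<lambda>z. Q z / a (F z)) \<longlongrightarrow> Q t / a (F t)) (at t)"
    using contQ contA pos by (intro tendsto_divide) (auto simp: isCont_def)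
  moreover have "\<forall>\<^sub>F z in at t. Q z / a (F z) = (F z - F t) / (z - t)"
  proof -
    have "\<forall>\<^sub>F z in at t. 0 < a (F z)" using contA pos unfolding isCont_def by (rule order_tendstoD)
    moreover have "\<forall>\<^sub>F z in at t. z \<noteq> t" by (simp add: eventually_at_filter)
    ultimately show ?thesis
    proof eventually_elim
      case (elim z)
      then show ?case using key[of z] by (simp add: field_simps)
    qed
  qed
  ultimately have "((\<lambda>z. (F z - F t) / (z - t)) \<longlongrightarrow> Q t / a (F t)) (at t)"
    by (rule Lim_transform_eventually)
  moreover have "Q t / a (F t) = F' t"
  proof -
    have "Q t = det2 (\<gamma>1 t) (v t) / 2"
      unfolding Q_def k(3) g(3) v_def by (simp add: det2_def field_simps)
    then show ?thesis by (simp add: a F'_def)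
  qed
  ultimately show ?thesis by (simp add: has_field_derivative_iff)
qed

lemma deriv_\<gamma>_F: "((\<lambda>t. \<gamma> (F t)) has_vector_derivative F' t *\<^sub>R \<gamma>1 (F t)) (at t)"
  by (rule has_vector_derivative_compose_real[OF deriv_\<gamma> deriv_F])

lemma deriv_\<gamma>1_F: "((\<lambda>t. \<gamma>1 (F t)) has_vector_derivative F' t *\<^sub>R \<gamma>2 (F t)) (at t)"
  by (rule has_vector_derivative_compose_real[OF deriv_\<gamma>1 deriv_F])

lemma deriv_v: "(v has_vector_derivative F' t *\<^sub>R \<gamma>1 (F t) - \<gamma>1 t) (at t)"
  unfolding v_def by (intro has_vector_derivative_diff deriv_\<gamma>_F deriv_\<gamma>)

text \<open>The formula for \<open>F'\<close> involves only \<gamma> and \<gamma>1, so a C^2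
  boundary still gives the far end point a second derivative in \<open>t\<close>.\<close>

lemma F'_differentiable: "\<exists>D. (F' has_real_derivative D) (at t)"
  unfolding F'_def
  by (rule exI, rule DERIV_divide[OF has_real_derivative_det2[OF deriv_\<gamma>1 deriv_v]
        has_real_derivative_det2[OF deriv_v deriv_\<gamma>1_F]]) (use v_det_pos(2)[of t] in simp)

text \<open>The cube of the derivative of \<open>\<sigma>_F\<close>. The left side is the
  determinant of the first two derivatives of the far end point, the term with the derivative of
  \<open>F'\<close> dropping out.\<close>

lemma curv_F: "curv (F t) * F' t ^ 3 = curv t"
proof -
  have "((\<lambda>t. \<sigma> (F t)) has_real_derivative root 3 (curv (F t)) * F' t) (at t)"
    by (rule DERIV_chain2[OF deriv_\<sigma> deriv_F])
  moreover have "((\<lambda>t. \<sigma> (F t)) has_real_derivative root 3 (curv t)) (at t)"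
    unfolding \<sigma>_F using DERIV_add[OF deriv_\<sigma> DERIV_const] by simp
  ultimately have "root 3 (curv (F t)) * F' t = root 3 (curv t)" by (rule DERIV_unique)
  then have "(root 3 (curv (F t)) * F' t) ^ 3 = root 3 (curv t) ^ 3" by simp
  then show ?thesis by (simp add: power_mult_distrib odd_real_root_pow)
qed

lemma chord_velocity:
  obtains c where "\<And>t. \<gamma>1 t + F' t *\<^sub>R \<gamma>1 (F t) = (c * det2 (\<gamma>1 t) (v t)) *\<^sub>R v t"
proof -
  \<comment> \<open>\<open>W\<close> is the sum of the end point velocities, twice the velocity of
    the midpoint of the chord. The goal becomes that \<open>lam / N\<close> has derivative
    zero.\<close>
  define W where "W t = \<gamma>1 t + F' t *\<^sub>R \<gamma>1 (F t)" for t
  define lam where "lam t = (v t \<bullet> W t) / (v t \<bullet> v t)" for t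
  define N where "N t = det2 (\<gamma>1 t) (v t)" for t
  have "det2 (v t) (W t) = 0" for t
    using v_det_pos(2)[of t]
    by (simp add: W_def F'_def det2.add_right det2.scaleR_right det2_swap[of "v t" "\<gamma>1 t"])
  then have W: "W t = lam t *\<^sub>R v t" for t
    using det2_eq_0_imp_scaleR[OF _ v_nonzero] by (simp add: lam_def)
  have "((\<lambda>t. lam t / N t) has_real_derivative 0) (at t)" for t
  proof -
    obtain F'' where F'': "(F' has_real_derivative F'') (at t)" using F'_differentiable by blast
    define q2 where "q2 = F' t *\<^sub>R (F' t *\<^sub>R \<gamma>2 (F t)) + F'' *\<^sub>R \<gamma>1 (F t)"
    define v' where "v' = F' t *\<^sub>R \<gamma>1 (F t) - \<gamma>1 t"
    have dW: "(W has_vector_derivative \<gamma>2 t + q2) (at t)"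
      unfolding W_def q2_def
      by (intro has_vector_derivative_add deriv_\<gamma>1 has_vector_derivative_scaleR F'' deriv_\<gamma>1_F)
    have dv: "(v has_vector_derivative v') (at t)" unfolding v'_def by (rule deriv_v)
    define N' where "N' = det2 (\<gamma>1 t) v' + det2 (\<gamma>2 t) (v t)"
    have dN: "(N has_real_derivative N') (at t)"
      unfolding N_def N'_def by (rule has_real_derivative_det2[OF deriv_\<gamma>1 dv])
    \<comment> \<open>Only differentiability is read off the projection formula; the value
      \<open>lam'\<close> is determined afterwards by comparing two expressions for the derivative
      of \<open>W\<close>.\<close>
    have "\<exists>D. (lam has_real_derivative D) (at t)"
    proof -
      have i: "((\<lambda>t. f t \<bullet> g t) has_real_derivative (f t \<bullet> g' + f' \<bullet> g t)) (at t)"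
        if "(f has_vector_derivative f') (at t)" "(g has_vector_derivative g') (at t)"
        for f g :: "real \<Rightarrow> real^2" and f' g'
        using bounded_bilinear.has_vector_derivative[OF bounded_bilinear_inner that]
        by (simp add: has_real_derivative_iff_has_vector_derivative)
      show ?thesis
        unfolding lam_def
        by (rule exI, rule DERIV_divide[OF i[OF dv dW] i[OF dv dv]]) (use v_nonzero[of t] in simp)
    qed
    then obtain lam' where dlam: "(lam has_real_derivative lam') (at t)" by blast
    have "((\<lambda>t. lam t *\<^sub>R v t) has_vector_derivative lam t *\<^sub>R v' + lam' *\<^sub>R v t) (at t)"
      by (rule has_vector_derivative_scaleR[OF dlam dv])
    then have "(W has_vector_derivative lam t *\<^sub>R v' + lam' *\<^sub>R v t) (at t)"
      unfolding W[symmetric] .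
    with dW have W': "\<gamma>2 t + q2 = lam t *\<^sub>R v' + lam' *\<^sub>R v t"
      by (rule vector_derivative_unique_at)
    have v'_eq: "v' = lam t *\<^sub>R v t - 2 *\<^sub>R \<gamma>1 t"
      using W[of t] by (simp add: W_def v'_def algebra_simps scaleR_2)
    have q1: "F' t *\<^sub>R \<gamma>1 (F t) = lam t *\<^sub>R v t - \<gamma>1 t"
      using W[of t] by (simp add: W_def algebra_simps)
    have "det2 (F' t *\<^sub>R \<gamma>1 (F t)) q2 = curv (F t) * F' t ^ 3"
      by (simp add: q2_def curv_def det2.add_right det2.scaleR_left det2.scaleR_right power3_eq_cube)
    \<comment> \<open>Equality of affine speeds, with the far velocity replaced by
      \<open>lam v - p'\<close>. Together with the pairings of \<open>W'\<close> with
      \<open>p'\<close> and \<open>v\<close> it eliminates the far acceleration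
      \<open>q2\<close>.\<close>
    then have aff: "det2 (lam t *\<^sub>R v t - \<gamma>1 t) q2 = det2 (\<gamma>1 t) (\<gamma>2 t)"
      by (simp add: q1 curv_F) (simp add: curv_def)
    have vv': "det2 (v t) v' = 2 * N t" and g1v': "det2 (\<gamma>1 t) v' = lam t * N t"
      by (simp_all add: v'_eq N_def det2.diff_right det2.scaleR_right det2_swap[of "v t" "\<gamma>1 t"])
    have 1: "det2 (\<gamma>1 t) (\<gamma>2 t) + det2 (\<gamma>1 t) q2 = lam t * det2 (\<gamma>1 t) v' + lam' * N t"
      using arg_cong[OF W', of "det2 (\<gamma>1 t)"] by (simp add: det2.add_right det2.scaleR_right N_def)
    have 2: "det2 (v t) (\<gamma>2 t) + det2 (v t) q2 = lam t * det2 (v t) v'"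
      using arg_cong[OF W', of "det2 (v t)"] by (simp add: det2.add_right det2.scaleR_right)
    have 3: "lam t * det2 (v t) q2 = det2 (\<gamma>1 t) q2 + det2 (\<gamma>1 t) (\<gamma>2 t)"
      using aff by (simp add: det2.diff_left det2.scaleR_left)
    have "lam t * det2 (v t) q2 = lam t * (2 * lam t * N t + det2 (\<gamma>2 t) (v t))"
      using 2 vv' det2_swap[of "v t" "\<gamma>2 t"] by (simp add: algebra_simps)
    then have "lam' * N t = lam t * N'"
      using 1 3 g1v' by (simp add: N'_def algebra_simps)
    then show ?thesis
      using DERIV_divide[OF dlam dN] v_det_pos(1)[of t] by (simp add: N_def)
  qed
  then have const: "lam t / N t = lam 0 / N 0" for t by (rule DERIV_isconst_all[rule_format])
  define c where "c = lam 0 / N 0"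
  have lam: "lam t = c * N t" for t
    using const[of t] v_det_pos(1)[of t] unfolding c_def[symmetric] by (simp add: N_def field_simps)
  show thesis
  proof (rule that)
    show "\<gamma>1 t + F' t *\<^sub>R \<gamma>1 (F t) = (c * det2 (\<gamma>1 t) (v t)) *\<^sub>R v t" for t
      using W[of t] unfolding lam W_def N_def .
  qed
qed

end

subsection \<open>Inscribed triangles\<close>

text \<open>Solving for the \<open>T\<close>s and pairing each with its side gives
  \<open>2 * D1 = c * S * (D2 + D3)\<close> and its cyclic images. Their sum, with positivity,
  forces \<open>c * S = 1\<close>; each \<open>D\<close> is then the mean of the other two, so all
  are equal and the side vectors combine to the opposite sides.\<close>

lemma tangents_parallel_to_opposite_sides:
  fixes T1 T2 T3 p1 p2 p3 :: "real^2"
  assumes e1: "T1 + T2 = (c * det2 T1 (p2 - p1)) *\<^sub>R (p2 - p1)"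
    and e2: "T2 + T3 = (c * det2 T2 (p3 - p2)) *\<^sub>R (p3 - p2)"
    and e3: "T3 + T1 = (c * det2 T3 (p1 - p3)) *\<^sub>R (p1 - p3)"
    and pos: "0 < det2 T1 (p2 - p1)" "0 < det2 T2 (p3 - p2)" "0 < det2 T3 (p1 - p3)"
  obtains f where "T1 = f *\<^sub>R (p2 - p3)" "T2 = f *\<^sub>R (p3 - p1)" "T3 = f *\<^sub>R (p1 - p2)"
proof -
  define D1 D2 D3 S where "D1 = det2 T1 (p2 - p1)" and "D2 = det2 T2 (p3 - p2)"
    and "D3 = det2 T3 (p1 - p3)" and "S = det2 (p2 - p1) (p3 - p2)"
  have S: "det2 (p1 - p3) (p2 - p1) = S" "det2 (p3 - p2) (p2 - p1) = - S"
      "det2 (p2 - p1) (p3 - p2) = S" "det2 (p1 - p3) (p3 - p2) = - S"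
      "det2 (p3 - p2) (p1 - p3) = S" "det2 (p2 - p1) (p1 - p3) = - S"
    by (simp_all add: S_def det2_def algebra_simps)
  note e = e1[folded D1_def] e2[folded D2_def] e3[folded D3_def]
  have "2 *\<^sub>R T1 = (T1 + T2) + (T3 + T1) - (T2 + T3)" "2 *\<^sub>R T2 = (T1 + T2) + (T2 + T3) - (T3 + T1)"
    "2 *\<^sub>R T3 = (T2 + T3) + (T3 + T1) - (T1 + T2)"
    by (simp_all add: scaleR_2)
  then have T: "2 *\<^sub>R T1 = (c * D1) *\<^sub>R (p2 - p1) + (c * D3) *\<^sub>R (p1 - p3) - (c * D2) *\<^sub>R (p3 - p2)"
    "2 *\<^sub>R T2 = (c * D1) *\<^sub>R (p2 - p1) + (c * D2) *\<^sub>R (p3 - p2) - (c * D3) *\<^sub>R (p1 - p3)"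
    "2 *\<^sub>R T3 = (c * D2) *\<^sub>R (p3 - p2) + (c * D3) *\<^sub>R (p1 - p3) - (c * D1) *\<^sub>R (p2 - p1)"
    unfolding e by simp_all
  have lin: "det2 (x *\<^sub>R a + y *\<^sub>R b - z *\<^sub>R d) u = x * det2 a u + y * det2 b u - z * det2 d u"
    for x y z and a b d u :: "real^2"
    by (simp add: det2.add_left det2.diff_left det2.scaleR_left)
  have "det2 (2 *\<^sub>R T1) (p2 - p1) = c * S * (D2 + D3)" "det2 (2 *\<^sub>R T2) (p3 - p2) = c * S * (D1 + D3)"
    "det2 (2 *\<^sub>R T3) (p1 - p3) = c * S * (D1 + D2)"
    unfolding T lin S det2_self by (simp_all add: algebra_simps)
  then have D: "2 * D1 = c * S * (D2 + D3)" "2 * D2 = c * S * (D1 + D3)" "2 * D3 = c * S * (D1 + D2)"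
    by (simp_all add: det2.scaleR_left D1_def D2_def D3_def)
  have "2 * (D1 + D2 + D3) = 2 * D1 + 2 * D2 + 2 * D3" by simp
  also have "\<dots> = c * S * (2 * (D1 + D2 + D3))" unfolding D by (simp add: algebra_simps)
  finally have "2 * (D1 + D2 + D3) = c * S * (2 * (D1 + D2 + D3))" .
  then have "c * S = 1" using pos by (simp add: D1_def D2_def D3_def)
  then have D_eq: "D2 = D1" "D3 = D1" using D by auto
  show thesis
  proof (rule that[of "c * D1"])
    show "T1 = (c * D1) *\<^sub>R (p2 - p3)" "T2 = (c * D1) *\<^sub>R (p3 - p1)" "T3 = (c * D1) *\<^sub>R (p1 - p2)"
      using T unfolding D_eq by (simp_all add: vec_eq_iff forall_2 algebra_simps)
  qed
qed

text \<open>The lines through the vertices parallel to the opposite sides bound a triangle whose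
  medial triangle is \<open>p1 p2 p3\<close>. If the \<open>q\<close>s slide on these lines by
  \<open>x1\<close>, \<open>x2\<close>, \<open>x3\<close>, the parallelism of the sides makes all
  pairwise sums vanish.\<close>

lemma medial_triangle_unique:
  fixes p1 p2 p3 q1 q2 q3 :: "real^2"
  assumes nz: "det2 (p2 - p3) (p2 - p1) \<noteq> 0"
    and on: "det2 (p2 - p3) (q1 - p1) = 0" "det2 (p3 - p1) (q2 - p2) = 0" "det2 (p1 - p2) (q3 - p3) = 0"
    and par: "det2 (p2 - p3) (q2 - q3) = 0" "det2 (p3 - p1) (q3 - q1) = 0" "det2 (p1 - p2) (q1 - q2) = 0"
  shows "q1 = p1"
proof -
  have ne: "p2 - p3 \<noteq> 0" "p3 - p1 \<noteq> 0" "p1 - p2 \<noteq> 0"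
    using nz by (auto simp: det2_def algebra_simps)
  obtain x1 x2 x3 where x: "q1 - p1 = x1 *\<^sub>R (p2 - p3)" "q2 - p2 = x2 *\<^sub>R (p3 - p1)" "q3 - p3 = x3 *\<^sub>R (p1 - p2)"
    using det2_eq_0_imp_scaleR[OF on(1) ne(1)] det2_eq_0_imp_scaleR[OF on(2) ne(2)]
      det2_eq_0_imp_scaleR[OF on(3) ne(3)] by blast
  then have q: "q1 = p1 + x1 *\<^sub>R (p2 - p3)" "q2 = p2 + x2 *\<^sub>R (p3 - p1)" "q3 = p3 + x3 *\<^sub>R (p1 - p2)"
    by (simp_all add: algebra_simps)
  let ?S = "det2 (p2 - p3) (p2 - p1)"
  have "det2 (p2 - p3) (q2 - q3) = (x2 + x3) * ?S" "det2 (p3 - p1) (q3 - q1) = (x1 + x3) * ?S"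
    "det2 (p1 - p2) (q1 - q2) = (x1 + x2) * ?S"
    unfolding q by (simp_all add: det2_def algebra_simps)
  then have "x2 + x3 = 0" "x1 + x3 = 0" "x1 + x2 = 0" using par nz by auto
  then have "x1 = 0" by linarith
  then show ?thesis using q by simp
qed

text \<open>One inclusion holds since \<open>K\<close> is the convex hull of its frontier. For the
  other, the open ellipse is connected, meets \<open>K\<close> and avoids its frontier, so it stays
  inside \<open>K\<close>.\<close>

lemma convex_body_eq_ellipse:
  fixes K :: "(real^2) set" and M :: "real^2^2"
  assumes K: "compact K" "convex K" "interior K \<noteq> {}" and M: "invertible M"
    and fr: "frontier K \<subseteq> (\<lambda>x. c + M *v x) ` sphere 0 1"
  shows "K = (\<lambda>x. c + M *v x) ` cball 0 1"
proof
  let ?g = "\<lambda>x. c + M *v x"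
  have img: "?g ` S = (+) c ` ((*v) M ` S)" for S by (simp add: image_image)
  have cv: "convex (?g ` S)" if "convex S" for S
    unfolding img using that by (intro convex_translation convex_linear_image) auto
  have inj: "inj ?g" using M by (auto simp: inj_def intro: inj_matrix_vector_mult[THEN injD])
  have cont: "continuous_on S ?g" for S by (intro continuous_intros matrix_vector_mult_linear_continuous_on)
  have "frontier K \<subseteq> ?g ` cball 0 1" using fr by fastforce
  then have "convex hull (frontier K) \<subseteq> ?g ` cball 0 1"
    by (intro hull_minimal cv convex_cball)
  then show sub: "K \<subseteq> ?g ` cball 0 1" using Krein_Milman_frontier[OF K(2,1)] by simp
  have clos: "?g ` cball 0 1 \<subseteq> closure (?g ` ball 0 1)"
    using image_closure_subset[OF cont closed_closure closure_subset, of "ball 0 1"] by simp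
  have "interior K \<inter> closure (?g ` ball 0 1) \<noteq> {}"
    using K(3) sub clos interior_subset by blast
  then have "interior K \<inter> ?g ` ball 0 1 \<noteq> {}" using open_Int_closure_eq_empty[OF open_interior] by blast
  then have ne: "?g ` ball 0 1 \<inter> K \<noteq> {}" using interior_subset by blast
  have "?g ` ball 0 1 \<inter> frontier K = {}"
  proof -
    have "?g ` ball 0 1 \<inter> ?g ` sphere 0 1 = ?g ` (ball 0 1 \<inter> sphere 0 1)"
      by (rule image_Int[OF inj, symmetric])
    also have "ball 0 1 \<inter> sphere 0 1 = ({} :: (real^2) set)" by auto
    finally show ?thesis using fr by blast
  qed
  moreover have "connected (?g ` ball 0 1)" by (rule convex_connected[OF cv[OF convex_ball]])
  ultimately have "?g ` ball 0 1 \<subseteq> K" using connected_Int_frontier[of "?g ` ball 0 1" K] ne by blast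
  then have "closure (?g ` ball 0 1) \<subseteq> K" by (rule closure_minimal) (rule compact_imp_closed[OF K(1)])
  then show "?g ` cball 0 1 \<subseteq> K" using clos by blast
qed

section \<open>Flat arcs: boundary arcs of zero affine length\<close>

context ccw_body begin

text \<open>Where \<sigma> is constant the curvature vanishes, so the acceleration is a multiple of
  the velocity and the unit tangent has derivative zero. This is checked componentwise, against
  every linear functional \<open>A\<close>.\<close>

lemma tangent_direction_const:
  assumes ab: "a < b" and eq: "\<sigma> a = \<sigma> b" and s: "a \<le> s" "s \<le> b"
  obtains k where "0 < k" "\<gamma>1 s = k *\<^sub>R \<gamma>1 a"
proof -
  have const: "\<sigma> x = \<sigma> a" if "a \<le> x" "x \<le> b" for x
    using \<sigma>_mono[OF that(1)] \<sigma>_mono[OF that(2)] eq by simp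
  have flat: "det2 (\<gamma>1 x) (\<gamma>2 x) = 0" if x: "a < x" "x < b" for x
  proof -
    have "root 3 (curv x) = 0"
    proof (rule DERIV_local_const[OF deriv_\<sigma>])
      show "0 < min (x - a) (b - x)" using x by simp
      show "\<forall>y. \<bar>x - y\<bar> < min (x - a) (b - x) \<longrightarrow> \<sigma> x = \<sigma> y"
      proof (intro allI impI)
        fix y assume "\<bar>x - y\<bar> < min (x - a) (b - x)"
        then have "a \<le> y" "y \<le> b" by linarith+
        then show "\<sigma> x = \<sigma> y" using const[of x] const[of y] x by simp
      qed
    qed
    then show ?thesis by (simp add: curv_def)
  qed
  have "A \<bullet> \<gamma>1 s / norm (\<gamma>1 s) = A \<bullet> \<gamma>1 a / norm (\<gamma>1 a)" for A
  proof (rule DERIV_isconst2[OF ab _ _ s, of "\<lambda>s. A \<bullet> \<gamma>1 s / norm (\<gamma>1 s)"])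
    show "continuous_on {a..b} (\<lambda>s. A \<bullet> \<gamma>1 s / norm (\<gamma>1 s))"
      using regular by (intro continuous_intros continuous_on_\<gamma>1) auto
    fix x assume x: "a < x" "x < b"
    have g2: "\<gamma>2 x = ((\<gamma>1 x \<bullet> \<gamma>2 x) / (\<gamma>1 x \<bullet> \<gamma>1 x)) *\<^sub>R \<gamma>1 x"
      by (rule det2_eq_0_imp_scaleR[OF flat[OF x] regular])
    define \<mu> where "\<mu> = (\<gamma>1 x \<bullet> \<gamma>2 x) / (\<gamma>1 x \<bullet> \<gamma>1 x)"
    have dA: "((\<lambda>s. A \<bullet> \<gamma>1 s) has_real_derivative \<mu> * (A \<bullet> \<gamma>1 x)) (at x)"
      using bounded_linear.has_vector_derivative[OF bounded_linear_inner_right deriv_\<gamma>1, of A x]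
      by (subst (asm) g2) (simp add: has_real_derivative_iff_has_vector_derivative \<mu>_def)
    have "((\<lambda>s. \<gamma>1 s \<bullet> \<gamma>1 s) has_real_derivative (\<gamma>1 x \<bullet> \<gamma>2 x + \<gamma>2 x \<bullet> \<gamma>1 x)) (at x)"
      using bounded_bilinear.has_vector_derivative[OF bounded_bilinear_inner deriv_\<gamma>1 deriv_\<gamma>1]
      by (simp add: has_real_derivative_iff_has_vector_derivative)
    moreover have "\<gamma>1 x \<bullet> \<gamma>2 x + \<gamma>2 x \<bullet> \<gamma>1 x = 2 * \<mu> * (norm (\<gamma>1 x))\<^sup>2"
      by (simp add: \<mu>_def inner_commute power2_norm_eq_inner regular)
    ultimately have d0: "((\<lambda>s. sqrt (\<gamma>1 s \<bullet> \<gamma>1 s)) has_real_derivative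
        inverse (sqrt (\<gamma>1 x \<bullet> \<gamma>1 x)) / 2 * (2 * \<mu> * (norm (\<gamma>1 x))\<^sup>2)) (at x)"
      using regular[of x] by (intro DERIV_chain2[OF DERIV_real_sqrt]) auto
    have e0: "inverse (norm (\<gamma>1 x)) / 2 * (2 * \<mu> * (norm (\<gamma>1 x))\<^sup>2) = \<mu> * norm (\<gamma>1 x)"
      using regular[of x] by (simp add: field_simps power2_eq_square)
    have dn: "((\<lambda>s. norm (\<gamma>1 s)) has_real_derivative \<mu> * norm (\<gamma>1 x)) (at x)"
      using d0 unfolding norm_eq_sqrt_inner[symmetric] e0 .
    show "((\<lambda>s. A \<bullet> \<gamma>1 s / norm (\<gamma>1 s)) has_real_derivative 0) (at x)"
      using DERIV_divide[OF dA dn] regular[of x] by simp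
  qed
  then have "A \<bullet> ((1 / norm (\<gamma>1 s)) *\<^sub>R \<gamma>1 s) = A \<bullet> ((1 / norm (\<gamma>1 a)) *\<^sub>R \<gamma>1 a)" for A by simp
  then have "(1 / norm (\<gamma>1 s)) *\<^sub>R \<gamma>1 s = (1 / norm (\<gamma>1 a)) *\<^sub>R \<gamma>1 a"
    by (metis inner_commute vector_eq_ldot)
  then have "norm (\<gamma>1 s) *\<^sub>R ((1 / norm (\<gamma>1 s)) *\<^sub>R \<gamma>1 s) = norm (\<gamma>1 s) *\<^sub>R ((1 / norm (\<gamma>1 a)) *\<^sub>R \<gamma>1 a)" by simp
  then have "\<gamma>1 s = (norm (\<gamma>1 s) / norm (\<gamma>1 a)) *\<^sub>R \<gamma>1 a" using regular by simp
  moreover have "0 < norm (\<gamma>1 s) / norm (\<gamma>1 a)" using regular by simp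
  ultimately show thesis using that by blast
qed

lemma chord_on_tangent_line:
  assumes ab: "a < b" and eq: "\<sigma> a = \<sigma> b"
  shows "det2 (\<gamma>1 a) (\<gamma> b - \<gamma> a) = 0"
proof -
  have "det2 (\<gamma>1 a) (\<gamma> b - \<gamma> a) = det2 (\<gamma>1 a) (\<gamma> a - \<gamma> a)"
  proof (rule DERIV_isconst2[OF ab, of "\<lambda>s. det2 (\<gamma>1 a) (\<gamma> s - \<gamma> a)"])
    show "continuous_on {a..b} (\<lambda>s. det2 (\<gamma>1 a) (\<gamma> s - \<gamma> a))"
      by (intro continuous_intros det2.continuous_on continuous_on_\<gamma>)
    fix x assume x: "a < x" "x < b"
    obtain k where "\<gamma>1 x = k *\<^sub>R \<gamma>1 a" using tangent_direction_const[OF ab eq, of x] x by auto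
    then have "det2 (\<gamma>1 a) (\<gamma>1 x - 0) = 0" by (simp add: det2.scaleR_right)
    moreover have "((\<lambda>s. det2 (\<gamma>1 a) (\<gamma> s - \<gamma> a)) has_real_derivative det2 (\<gamma>1 a) (\<gamma>1 x - 0)) (at x)"
      by (intro has_real_derivative_det2_right has_vector_derivative_diff deriv_\<gamma> has_vector_derivative_const)
    ultimately show "((\<lambda>s. det2 (\<gamma>1 a) (\<gamma> s - \<gamma> a)) has_real_derivative 0) (at x)" by simp
  qed (use ab in auto)
  then show ?thesis by (simp add: det2.zero_right)
qed

text \<open>Otherwise the tangent direction would be constant over a whole period, and a curve
  advancing steadily in one direction does not close up.\<close>

lemma total_affine_length_pos: "\<sigma> 0 < \<sigma> L"
proof (rule ccontr)
  assume "\<not> ?thesis"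
  then have eq: "\<sigma> 0 = \<sigma> L" using \<sigma>_mono[of 0 L] L_pos by simp
  have "\<gamma>1 0 \<bullet> \<gamma> 0 < \<gamma>1 0 \<bullet> \<gamma> L"
  proof (rule DERIV_pos_imp_increasing[OF L_pos, of "\<lambda>s. \<gamma>1 0 \<bullet> \<gamma> s"])
    fix x assume x: "0 \<le> x" "x \<le> L"
    obtain k where k: "0 < k" "\<gamma>1 x = k *\<^sub>R \<gamma>1 0" using tangent_direction_const[OF L_pos eq x] by blast
    have "((\<lambda>s. \<gamma>1 0 \<bullet> \<gamma> s) has_real_derivative \<gamma>1 0 \<bullet> \<gamma>1 x) (at x)"
      using bounded_linear.has_vector_derivative[OF bounded_linear_inner_right deriv_\<gamma>]
      by (simp add: has_real_derivative_iff_has_vector_derivative)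
    moreover have "0 < \<gamma>1 0 \<bullet> \<gamma>1 x" using k regular[of 0] by simp
    ultimately show "\<exists>y. ((\<lambda>s. \<gamma>1 0 \<bullet> \<gamma> s) has_real_derivative y) (at x) \<and> 0 < y" by blast
  qed
  then show False using periodic[of 0] by simp
qed

lemma \<sigma>_less_shift: "\<sigma> t < \<sigma> (t + L)"
  using total_affine_length_pos by (simp add: \<sigma>_shift)

text \<open>The left end of a maximal flat arc, a single point counting as such an arc: \<sigma>
  grows strictly up to \<open>x\<close>.\<close>

definition left_end :: "real \<Rightarrow> bool" where
  "left_end x \<longleftrightarrow> (\<forall>t<x. \<sigma> t < \<sigma> x)"

definition right_end :: "real \<Rightarrow> bool" where
  "right_end x \<longleftrightarrow> (\<forall>t>x. \<sigma> x < \<sigma> t)"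

text \<open>A fibre of \<sigma> is closed, and it is bounded because \<sigma> gains a positive
  amount in every period; its infimum and supremum are the ends.\<close>

lemma fibre_ends:
  obtains \<alpha> \<beta> where "\<alpha> \<le> t" "t \<le> \<beta>" "\<sigma> \<alpha> = \<sigma> t" "\<sigma> \<beta> = \<sigma> t" "left_end \<alpha>" "right_end \<beta>"
    "\<And>s. \<sigma> s = \<sigma> t \<Longrightarrow> \<alpha> \<le> s \<and> s \<le> \<beta>"
proof -
  let ?X = "{s. \<sigma> s = \<sigma> t}"
  have "continuous_on UNIV \<sigma>"
    using DERIV_isCont[OF deriv_\<sigma>] by (simp add: continuous_on_eq_continuous_at)
  then have cl: "closed ?X" by (intro closed_Collect_eq continuous_on_const)
  have bnd: "t - L \<le> s \<and> s \<le> t + L" if "\<sigma> s = \<sigma> t" for s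
  proof (rule ccontr)
    assume "\<not> ?thesis"
    then consider "s \<le> t - L" | "t + L \<le> s" by linarith
    then show False
      using \<sigma>_mono[of s "t - L"] \<sigma>_mono[of "t + L" s] \<sigma>_less_shift[of t] \<sigma>_less_shift[of "t - L"] that
      by cases auto
  qed
  have bb: "bdd_below ?X" "bdd_above ?X" using bnd by (auto intro!: bdd_belowI bdd_aboveI)
  have t: "t \<in> ?X" by simp
  define \<alpha> \<beta> where "\<alpha> = Inf ?X" and "\<beta> = Sup ?X"
  have \<alpha>: "\<alpha> \<in> ?X" and \<beta>: "\<beta> \<in> ?X"
    unfolding \<alpha>_def \<beta>_def using closed_contains_Inf[OF _ bb(1) cl] closed_contains_Sup[OF _ bb(2) cl] t by blast+
  have le: "\<alpha> \<le> s \<and> s \<le> \<beta>" if "\<sigma> s = \<sigma> t" for s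
    unfolding \<alpha>_def \<beta>_def using that bb by (auto intro: cInf_lower cSup_upper)
  have "left_end \<alpha>"
    unfolding left_end_def
  proof (intro allI impI)
    fix s assume "s < \<alpha>"
    then show "\<sigma> s < \<sigma> \<alpha>" using le[of s] \<sigma>_mono[of s \<alpha>] \<alpha> by fastforce
  qed
  moreover have "right_end \<beta>"
    unfolding right_end_def
  proof (intro allI impI)
    fix s assume "\<beta> < s"
    then show "\<sigma> \<beta> < \<sigma> s" using le[of s] \<sigma>_mono[of \<beta> s] \<beta> by fastforce
  qed
  ultimately show thesis using that[of \<alpha> \<beta>] le \<alpha> \<beta> by simp
qed

end

section \<open>Closing up of three consecutive chords, and exclusion of flat arcs\<close>

context equiaffine_flotation begin

definition P :: "real \<Rightarrow> real" where
  "P t = F (F (F t))"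

definition P' :: "real \<Rightarrow> real" where
  "P' t = F' (F (F t)) * (F' (F t) * F' t)"

lemma deriv_P: "(P has_real_derivative P' t) (at t)"
  unfolding P_def P'_def by (intro DERIV_chain2[OF deriv_F] deriv_F)

lemma isCont_P: "isCont P t"
  using deriv_P DERIV_isCont by blast

text \<open>Three thirds make one full turn, but only as measured by \<sigma>:
  \<open>P t - L\<close> lies in the fibre of \<open>t\<close> and might still differ from
  \<open>t\<close>.\<close>

lemma \<sigma>_P: "\<sigma> (P t - L) = \<sigma> t"
proof -
  define l where "l = (\<sigma> L - \<sigma> 0) / 3"
  have "\<sigma> L - \<sigma> 0 = 3 * l" by (simp add: l_def)
  then have "\<sigma> (P t) = \<sigma> (P t - L) + 3 * l" using \<sigma>_shift[of "P t - L"] by simp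
  moreover have "\<sigma> (F s) = \<sigma> s + l" for s using \<sigma>_F[of s] by (simp only: l_def)
  then have "\<sigma> (P t) = \<sigma> t + l + l + l" by (simp add: P_def)
  ultimately show ?thesis by simp
qed

lemma F_strict_mono: "s < t \<Longrightarrow> F s < F t"
  by (rule DERIV_pos_imp_increasing[of s t F]) (use deriv_F F'_pos in metis)+

text \<open>\<open>P x - L\<close> lies in the fibre of \<open>x\<close>, so not to the left of
  \<open>x\<close>. Were it to the right, continuity would also send points just left of
  \<open>x\<close> to the right of \<open>x\<close>, although their fibres lie to the left.\<close>

lemma P_left_end:
  assumes "left_end x"
  shows "P x = x + L"
proof (rule antisym)
  show "x + L \<le> P x"
  proof (rule ccontr)
    assume "\<not> ?thesis"
    then have "P x - L < x" by simp
    then show False using assms \<sigma>_P[of x] by (auto simp: left_end_def)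
  qed
  show "P x \<le> x + L"
  proof (rule ccontr)
    assume "\<not> ?thesis"
    then have "\<forall>\<^sub>F y in at x. x + L < P y"
      using isCont_P[of x] by (intro order_tendstoD(1)[of P "P x"]) (auto simp: isCont_def)
    then obtain d where d: "d > 0" "\<And>y. y \<noteq> x \<Longrightarrow> dist y x < d \<Longrightarrow> x + L < P y"
      unfolding eventually_at by auto
    have "x + L < P (x - d/2)" using d by (auto simp: dist_real_def)
    then have "\<sigma> x \<le> \<sigma> (P (x - d/2) - L)" by (intro \<sigma>_mono) simp
    moreover have "\<sigma> (x - d/2) < \<sigma> x" using assms d(1) by (simp add: left_end_def)
    ultimately show False by (simp add: \<sigma>_P)
  qed
qed

lemma P_right_end:
  assumes "right_end x"
  shows "P x = x + L"
proof (rule antisym)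
  show "P x \<le> x + L"
  proof (rule ccontr)
    assume "\<not> ?thesis"
    then have "x < P x - L" by simp
    then show False using assms \<sigma>_P[of x] by (auto simp: right_end_def)
  qed
  show "x + L \<le> P x"
  proof (rule ccontr)
    assume "\<not> ?thesis"
    then have "\<forall>\<^sub>F y in at x. P y < x + L"
      using isCont_P[of x] by (intro order_tendstoD(2)[of P "P x"]) (auto simp: isCont_def)
    then obtain d where d: "d > 0" "\<And>y. y \<noteq> x \<Longrightarrow> dist y x < d \<Longrightarrow> P y < x + L"
      unfolding eventually_at by auto
    have "P (x + d/2) < x + L" using d by (auto simp: dist_real_def)
    then have "\<sigma> (P (x + d/2) - L) \<le> \<sigma> x" by (intro \<sigma>_mono) simp
    moreover have "\<sigma> x < \<sigma> (x + d/2)" using assms d(1) by (simp add: right_end_def)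
    ultimately show False by (simp add: \<sigma>_P)
  qed
qed

text \<open>At points \<open>y\<close> arbitrarily close to \<open>x\<close> the difference quotient
  of \<open>P\<close> is exactly one, so its limit cannot differ from one.\<close>

lemma P'_limit_point:
  assumes x: "P x = x + L" and lim: "\<And>d. 0 < d \<Longrightarrow> \<exists>y. y \<noteq> x \<and> \<bar>y - x\<bar> < d \<and> P y = y + L"
  shows "P' x = 1"
proof (rule ccontr)
  assume ne: "P' x \<noteq> 1"
  obtain g where g: "\<And>z. P z - P x = g z * (z - x)" "isCont g x" "g x = P' x"
    using deriv_P[of x] unfolding CARAT_DERIV by metis
  have "\<forall>\<^sub>F z in at x. g z \<noteq> 1"
    using g(2,3) ne unfolding isCont_def by (intro tendsto_imp_eventually_ne[of g "P' x"]) auto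
  then obtain d where d: "d > 0" "\<And>y. y \<noteq> x \<Longrightarrow> dist y x < d \<Longrightarrow> g y \<noteq> 1"
    unfolding eventually_at by auto
  obtain y where y: "y \<noteq> x" "\<bar>y - x\<bar> < d" "P y = y + L" using lim[OF d(1)] by blast
  have "g y * (y - x) = 1 * (y - x)" using g(1)[of y] x y by simp
  then have "g y = 1" using y(1) by simp
  then show False using d(2)[of y] y by (simp add: dist_real_def)
qed

text \<open>Right ends accumulate at a left end from the left: the fibre of \<open>x - d/2\<close>
  ends before \<open>x\<close>, and at its right end \<open>P\<close> is again the shift by
  \<open>L\<close>.\<close>

lemma P'_left_end:
  assumes "left_end x"
  shows "P' x = 1"
proof (rule P'_limit_point[OF P_left_end[OF assms]])
  fix d :: real assume d: "0 < d"
  obtain \<beta> where \<beta>: "x - d/2 \<le> \<beta>" "\<sigma> \<beta> = \<sigma> (x - d/2)" "right_end \<beta>" by (metis fibre_ends)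
  have "\<sigma> \<beta> < \<sigma> x" using \<beta>(2) assms d by (simp add: left_end_def)
  then have "\<beta> < x" using \<sigma>_mono[of x \<beta>] by linarith
  then show "\<exists>y. y \<noteq> x \<and> \<bar>y - x\<bar> < d \<and> P y = y + L"
    using \<beta> d P_right_end[OF \<beta>(3)] by (intro exI[of _ \<beta>]) auto
qed

lemma P'_right_end:
  assumes "right_end x"
  shows "P' x = 1"
proof (rule P'_limit_point[OF P_right_end[OF assms]])
  fix d :: real assume d: "0 < d"
  obtain \<alpha> where \<alpha>: "\<alpha> \<le> x + d/2" "\<sigma> \<alpha> = \<sigma> (x + d/2)" "left_end \<alpha>" by (metis fibre_ends)
  have "\<sigma> x < \<sigma> \<alpha>" using \<alpha>(2) assms d by (simp add: right_end_def)
  then have "x < \<alpha>" using \<sigma>_mono[of \<alpha> x] by linarith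
  then show "\<exists>y. y \<noteq> x \<and> \<bar>y - x\<bar> < d \<and> P y = y + L"
    using \<alpha> d P_left_end[OF \<alpha>(3)] by (intro exI[of _ \<alpha>]) auto
qed

text \<open>\<open>chord_velocity\<close> is applied to the three consecutive chords, with all
  vertices moving as functions of the one parameter \<open>t\<close>. The condition
  \<open>P' t = 1\<close> makes the velocity after the third step equal to the initial one, so the
  three relations form a cycle.\<close>

lemma closed_triangle:
  assumes P: "P t = t + L" and P': "P' t = 1"
  obtains f where "\<gamma>1 t = f *\<^sub>R (\<gamma> (F t) - \<gamma> (F (F t)))"
    "F' t *\<^sub>R \<gamma>1 (F t) = f *\<^sub>R (\<gamma> (F (F t)) - \<gamma> t)"
    "(F' (F t) * F' t) *\<^sub>R \<gamma>1 (F (F t)) = f *\<^sub>R (\<gamma> t - \<gamma> (F t))"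
proof -
  obtain c where c: "\<And>t. \<gamma>1 t + F' t *\<^sub>R \<gamma>1 (F t) = (c * det2 (\<gamma>1 t) (v t)) *\<^sub>R v t"
    using chord_velocity by blast
  let ?p1 = "\<gamma> t" and ?p2 = "\<gamma> (F t)" and ?p3 = "\<gamma> (F (F t))"
  let ?T1 = "\<gamma>1 t" and ?T2 = "F' t *\<^sub>R \<gamma>1 (F t)" and ?T3 = "(F' (F t) * F' t) *\<^sub>R \<gamma>1 (F (F t))"
  have v1: "v t = ?p2 - ?p1" and v2: "v (F t) = ?p3 - ?p2" and v3: "v (F (F t)) = ?p1 - ?p3"
    using P by (simp_all add: v_def P_def periodic)
  have T1: "?T1 = (F' (F (F t)) * (F' (F t) * F' t)) *\<^sub>R \<gamma>1 (F (F (F t)))"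
    using P P' by (simp add: P_def P'_def periodic_\<gamma>1)
  have e1: "?T1 + ?T2 = (c * det2 ?T1 (?p2 - ?p1)) *\<^sub>R (?p2 - ?p1)" using c[of t] v1 by simp
  have e2: "?T2 + ?T3 = (c * det2 ?T2 (?p3 - ?p2)) *\<^sub>R (?p3 - ?p2)"
    \<comment> \<open>The relation is homogeneous of degree one in the velocities, so multiplying by
      the chain rule factor \<open>F' t\<close> turns it into the relation for the actual vertex
      velocities.\<close>
    using arg_cong[OF c[of "F t"], of "\<lambda>x. F' t *\<^sub>R x"]
    by (simp add: v2 det2.scaleR_left scaleR_add_right mult.commute mult.left_commute)
  have e3: "?T3 + ?T1 = (c * det2 ?T3 (?p1 - ?p3)) *\<^sub>R (?p1 - ?p3)"
  proof -
    have "?T3 + ?T1 = (F' (F t) * F' t) *\<^sub>R (\<gamma>1 (F (F t)) + F' (F (F t)) *\<^sub>R \<gamma>1 (F (F (F t))))"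
      by (subst T1) (simp add: scaleR_add_right mult.commute)
    also have "\<dots> = (c * det2 ?T3 (?p1 - ?p3)) *\<^sub>R (?p1 - ?p3)"
      unfolding c v3 by (simp add: det2.scaleR_left mult.commute mult.left_commute)
    finally show ?thesis .
  qed
  have pos: "0 < det2 ?T1 (?p2 - ?p1)" "0 < det2 ?T2 (?p3 - ?p2)" "0 < det2 ?T3 (?p1 - ?p3)"
    using v_det_pos(1)[of t] v_det_pos(1)[of "F t"] v_det_pos(1)[of "F (F t)"] F'_pos
    by (simp_all add: v1 v2 v3 det2.scaleR_left)
  show thesis using tangents_parallel_to_opposite_sides[OF e1 e2 e3 pos] that by blast
qed

lemma closed_triangle_nondegenerate:
  assumes "P t = t + L" "P' t = 1"
  shows "det2 (\<gamma> (F t) - \<gamma> (F (F t))) (\<gamma> (F t) - \<gamma> t) \<noteq> 0"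
proof -
  obtain f where "\<gamma>1 t = f *\<^sub>R (\<gamma> (F t) - \<gamma> (F (F t)))" using closed_triangle[OF assms] by blast
  then show ?thesis using v_det_pos(1)[of t] by (auto simp: v_def det2.scaleR_left)
qed

lemma closed_triangle_parallel:
  assumes "P t = t + L" "P' t = 1"
  shows "det2 (\<gamma>1 t) x = 0 \<longleftrightarrow> det2 (\<gamma> (F t) - \<gamma> (F (F t))) x = 0"
    "det2 (\<gamma>1 (F t)) x = 0 \<longleftrightarrow> det2 (\<gamma> (F (F t)) - \<gamma> t) x = 0"
    "det2 (\<gamma>1 (F (F t))) x = 0 \<longleftrightarrow> det2 (\<gamma> t - \<gamma> (F t)) x = 0"
proof -
  obtain f where f: "\<gamma>1 t = f *\<^sub>R (\<gamma> (F t) - \<gamma> (F (F t)))"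
    "F' t *\<^sub>R \<gamma>1 (F t) = f *\<^sub>R (\<gamma> (F (F t)) - \<gamma> t)"
    "(F' (F t) * F' t) *\<^sub>R \<gamma>1 (F (F t)) = f *\<^sub>R (\<gamma> t - \<gamma> (F t))"
    using closed_triangle[OF assms] by blast
  have "f \<noteq> 0" using f(1) regular[of t] by auto
  then show "det2 (\<gamma>1 t) x = 0 \<longleftrightarrow> det2 (\<gamma> (F t) - \<gamma> (F (F t))) x = 0"
    "det2 (\<gamma>1 (F t)) x = 0 \<longleftrightarrow> det2 (\<gamma> (F (F t)) - \<gamma> t) x = 0"
    "det2 (\<gamma>1 (F (F t))) x = 0 \<longleftrightarrow> det2 (\<gamma> t - \<gamma> (F t)) x = 0"
    using arg_cong[OF f(1), of "\<lambda>y. det2 y x"] arg_cong[OF f(2), of "\<lambda>y. det2 y x"]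
      arg_cong[OF f(3), of "\<lambda>y. det2 y x"] F'_pos[of t] F'_pos[of "F t"]
    by (auto simp: det2.scaleR_left)
qed

text \<open>On a maximal flat arc the three tangent lines do not move, and at both of its ends the inscribed
  triangle is the medial triangle of the triangle they form; so the arc is a single point.\<close>

lemma \<sigma>_strict_mono:
  assumes "a < b"
  shows "\<sigma> a < \<sigma> b"
proof (rule ccontr)
  assume "\<not> ?thesis"
  then have eq: "\<sigma> b = \<sigma> a" using \<sigma>_mono[of a b] assms by simp
  obtain \<alpha> \<beta> where ab: "\<sigma> \<alpha> = \<sigma> a" "\<sigma> \<beta> = \<sigma> a" "left_end \<alpha>" "right_end \<beta>"
      and le: "\<And>s. \<sigma> s = \<sigma> a \<Longrightarrow> \<alpha> \<le> s \<and> s \<le> \<beta>"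
    by (metis fibre_ends)
  have less: "\<alpha> < \<beta>" using le[OF eq] le[of a] assms by simp
  have flat: "det2 (\<gamma>1 s) (\<gamma> s' - \<gamma> s) = 0" "\<And>x. det2 (\<gamma>1 s') x = 0 \<longleftrightarrow> det2 (\<gamma>1 s) x = 0"
    if st: "s < s'" "\<sigma> s = \<sigma> s'" for s s'
  proof -
    show "det2 (\<gamma>1 s) (\<gamma> s' - \<gamma> s) = 0" by (rule chord_on_tangent_line[OF st])
    obtain k where "0 < k" "\<gamma>1 s' = k *\<^sub>R \<gamma>1 s" using tangent_direction_const[OF st, of s'] st by auto
    then show "\<And>x. det2 (\<gamma>1 s') x = 0 \<longleftrightarrow> det2 (\<gamma>1 s) x = 0" by (simp add: det2.scaleR_left)
  qed
  have less': "F \<alpha> < F \<beta>" "F (F \<alpha>) < F (F \<beta>)" using F_strict_mono less by auto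
  have \<sigma>_eq: "\<sigma> \<alpha> = \<sigma> \<beta>" "\<sigma> (F \<alpha>) = \<sigma> (F \<beta>)" "\<sigma> (F (F \<alpha>)) = \<sigma> (F (F \<beta>))"
    using ab by (simp_all add: \<sigma>_F)
  note A = P_left_end[OF ab(3)] P'_left_end[OF ab(3)]
  note B = P_right_end[OF ab(4)] P'_right_end[OF ab(4)]
  have "\<gamma> \<beta> = \<gamma> \<alpha>"
  proof (rule medial_triangle_unique[OF closed_triangle_nondegenerate[OF A]])
    show "det2 (\<gamma> (F \<alpha>) - \<gamma> (F (F \<alpha>))) (\<gamma> \<beta> - \<gamma> \<alpha>) = 0"
      using flat(1)[OF less \<sigma>_eq(1)] closed_triangle_parallel(1)[OF A] by simp
    show "det2 (\<gamma> (F (F \<alpha>)) - \<gamma> \<alpha>) (\<gamma> (F \<beta>) - \<gamma> (F \<alpha>)) = 0"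
      using flat(1)[OF less'(1) \<sigma>_eq(2)] closed_triangle_parallel(2)[OF A] by simp
    show "det2 (\<gamma> \<alpha> - \<gamma> (F \<alpha>)) (\<gamma> (F (F \<beta>)) - \<gamma> (F (F \<alpha>))) = 0"
      using flat(1)[OF less'(2) \<sigma>_eq(3)] closed_triangle_parallel(3)[OF A] by simp
    show "det2 (\<gamma> (F \<alpha>) - \<gamma> (F (F \<alpha>))) (\<gamma> (F \<beta>) - \<gamma> (F (F \<beta>))) = 0"
      using flat(2)[OF less \<sigma>_eq(1)] closed_triangle_parallel(1)[OF A] closed_triangle_parallel(1)[OF B]
      by (metis det2_self)
    show "det2 (\<gamma> (F (F \<alpha>)) - \<gamma> \<alpha>) (\<gamma> (F (F \<beta>)) - \<gamma> \<beta>) = 0"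
      using flat(2)[OF less'(1) \<sigma>_eq(2)] closed_triangle_parallel(2)[OF A] closed_triangle_parallel(2)[OF B]
      by (metis det2_self)
    show "det2 (\<gamma> \<alpha> - \<gamma> (F \<alpha>)) (\<gamma> \<beta> - \<gamma> (F \<beta>)) = 0"
      using flat(2)[OF less'(2) \<sigma>_eq(3)] closed_triangle_parallel(3)[OF A] closed_triangle_parallel(3)[OF B]
      by (metis det2_self)
  qed
  \<comment> \<open>Coinciding boundary points give coinciding parameters only within one period; a
    longer flat arc would contain a whole turn.\<close>
  moreover have "\<beta> < \<alpha> + L"
    using \<sigma>_mono[of "\<alpha> + L" \<beta>] \<sigma>_less_shift[of \<alpha>] \<sigma>_eq(1) by linarith
  ultimately have "\<beta> = \<alpha>" using less by (intro \<gamma>_inj) auto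
  then show False using less by simp
qed

text \<open>Once \<sigma> is strictly increasing, every parameter is a left end.\<close>

lemma P_eq: "P t = t + L" and P'_eq: "P' t = 1"
  using P_left_end P'_left_end \<sigma>_strict_mono by (auto simp: left_end_def)

end

subsection \<open>The ellipse\<close>

context equiaffine_flotation begin

text \<open>The quadratic invariants \<open>x\<^sup>2 + z\<^sup>2\<close>, \<open>y\<^sup>2 + w\<^sup>2\<close>, \<open>x y + z w\<close> of the oscillator replace the
  reparametrisation and the solution of its equation.\<close>

lemma boundary_on_ellipse:
  obtains M :: "real^2^2" and c where "invertible M" "frontier K \<subseteq> (\<lambda>x. c + M *v x) ` sphere 0 1"
proof -
  have "\<exists>f. \<forall>t. \<gamma>1 t = f t *\<^sub>R (\<gamma> (F t) - \<gamma> (F (F t))) \<and>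
      F' t *\<^sub>R \<gamma>1 (F t) = f t *\<^sub>R (\<gamma> (F (F t)) - \<gamma> t) \<and>
      (F' (F t) * F' t) *\<^sub>R \<gamma>1 (F (F t)) = f t *\<^sub>R (\<gamma> t - \<gamma> (F t))"
    by (intro choice allI) (use closed_triangle[OF P_eq P'_eq] in metis)
  then obtain f where f: "\<And>t. \<gamma>1 t = f t *\<^sub>R (\<gamma> (F t) - \<gamma> (F (F t)))"
      "\<And>t. F' t *\<^sub>R \<gamma>1 (F t) = f t *\<^sub>R (\<gamma> (F (F t)) - \<gamma> t)"
      "\<And>t. (F' (F t) * F' t) *\<^sub>R \<gamma>1 (F (F t)) = f t *\<^sub>R (\<gamma> t - \<gamma> (F t))" by blast
  have d1: "(\<gamma> has_vector_derivative f t *\<^sub>R (\<gamma> (F t) - \<gamma> (F (F t)))) (at t)" for t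
    using deriv_\<gamma>[of t] unfolding f(1) .
  have d2: "((\<lambda>t. \<gamma> (F t)) has_vector_derivative f t *\<^sub>R (\<gamma> (F (F t)) - \<gamma> t)) (at t)" for t
    using deriv_\<gamma>_F[of t] unfolding f(2) .
  have d3: "((\<lambda>t. \<gamma> (F (F t))) has_vector_derivative f t *\<^sub>R (\<gamma> t - \<gamma> (F t))) (at t)" for t
    using has_vector_derivative_compose_real[OF deriv_\<gamma> DERIV_chain2[OF deriv_F deriv_F], of t]
    unfolding f(3) .
  define C where "C t = \<gamma> t + \<gamma> (F t) + \<gamma> (F (F t))" for t
  have "(C has_vector_derivative 0) (at t)" for t
  proof -
    have "(C has_vector_derivative (f t *\<^sub>R (\<gamma> (F t) - \<gamma> (F (F t))) + f t *\<^sub>R (\<gamma> (F (F t)) - \<gamma> t)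
        + f t *\<^sub>R (\<gamma> t - \<gamma> (F t)))) (at t)"
      unfolding C_def by (intro has_vector_derivative_add d1 d2 d3)
    then show ?thesis by (simp add: algebra_simps)
  qed
  then have C: "C t = C 0" for t
    using has_vector_derivative_zero_constant[of UNIV C] by (metis UNIV_I convex_UNIV)
  define c0 where "c0 = (1/3) *\<^sub>R C 0"
  define X where "X t = \<gamma> t - c0" for t
  \<comment> \<open>The factor balances the system: with centroid \<open>c0\<close>, differentiating
    the side brings out three times the vertex vector, so the scaled side and the vertex vector
    rotate into each other at the common rate \<open>sqrt 3 * f t\<close>.\<close>
  define Y where "Y t = (1 / sqrt 3) *\<^sub>R (\<gamma> (F t) - \<gamma> (F (F t)))" for t
  have c0: "3 *\<^sub>R c0 = \<gamma> t + \<gamma> (F t) + \<gamma> (F (F t))" for t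
    using C[of t] by (simp add: c0_def C_def)
  have dX: "(X has_vector_derivative (sqrt 3 * f t) *\<^sub>R Y t) (at t)" for t
  proof -
    have "(X has_vector_derivative f t *\<^sub>R (\<gamma> (F t) - \<gamma> (F (F t))) - 0) (at t)"
      unfolding X_def by (intro has_vector_derivative_diff d1 has_vector_derivative_const)
    then show ?thesis by (simp add: Y_def)
  qed
  have dY: "(Y has_vector_derivative - (sqrt 3 * f t) *\<^sub>R X t) (at t)" for t
  proof -
    have "(Y has_vector_derivative (1 / sqrt 3) *\<^sub>R (f t *\<^sub>R (\<gamma> (F (F t)) - \<gamma> t) - f t *\<^sub>R (\<gamma> t - \<gamma> (F t)))) (at t)"
      unfolding Y_def
      by (intro bounded_linear.has_vector_derivative[OF bounded_linear_scaleR_right] has_vector_derivative_diff d2 d3)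
    moreover have "f t *\<^sub>R (\<gamma> (F (F t)) - \<gamma> t) - f t *\<^sub>R (\<gamma> t - \<gamma> (F t)) = - (3 * f t) *\<^sub>R X t"
    proof -
      have "f t *\<^sub>R (\<gamma> (F (F t)) - \<gamma> t) - f t *\<^sub>R (\<gamma> t - \<gamma> (F t)) = f t *\<^sub>R (3 *\<^sub>R c0 - 3 *\<^sub>R \<gamma> t)"
        unfolding c0[of t] by (simp add: vec_eq_iff forall_2 algebra_simps)
      also have "\<dots> = - (3 * f t) *\<^sub>R X t" by (simp add: X_def algebra_simps)
      finally show ?thesis .
    qed
    moreover have "(1 / sqrt 3) * (3 * f t) = sqrt 3 * f t"
      by (simp add: field_simps)
    ultimately show ?thesis by simp
  qed
  define s0 where "s0 = det2 (X 0) (Y 0)"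
  have "s0 \<noteq> 0"
  proof -
    have X0: "3 *\<^sub>R X 0 = 2 *\<^sub>R \<gamma> 0 - \<gamma> (F 0) - \<gamma> (F (F 0))"
      using c0[of 0] by (simp add: X_def algebra_simps vec_eq_iff forall_2)
    have "det2 (3 *\<^sub>R X 0) (sqrt 3 *\<^sub>R Y 0) = 2 * det2 (\<gamma> (F 0) - \<gamma> (F (F 0))) (\<gamma> (F 0) - \<gamma> 0)"
      unfolding X0 by (simp add: Y_def det2_def algebra_simps)
    then show ?thesis
      using closed_triangle_nondegenerate[OF P_eq P'_eq, of 0]
      by (auto simp: s0_def det2.scaleR_left det2.scaleR_right)
  qed
  \<comment> \<open>By Cramer's rule \<open>x\<close>, \<open>y\<close> are the coordinates of
    \<open>X t\<close>, and \<open>z\<close>, \<open>w\<close> those of \<open>Y t\<close>, in the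
    basis \<open>X 0\<close>, \<open>Y 0\<close>.\<close>
  define x where "x t = det2 (X t) (Y 0) / s0" for t
  define y where "y t = det2 (X 0) (X t) / s0" for t
  define z where "z t = det2 (Y t) (Y 0) / s0" for t
  define w where "w t = det2 (X 0) (Y t) / s0" for t
  have dl: "((\<lambda>t. det2 (g t) a) has_real_derivative det2 g' a) (at t)"
    if "(g has_vector_derivative g') (at t)" for g g' a t
    using has_real_derivative_det2[OF that has_vector_derivative_const, of a] by (simp add: det2.zero_right)
  have dx: "(x has_real_derivative sqrt 3 * f t * z t) (at t)" for t
    unfolding x_def z_def using DERIV_cdivide[OF dl[OF dX[of t]], of "Y 0" s0] by (simp add: det2.scaleR_left)
  have dz: "(z has_real_derivative - (sqrt 3 * f t * x t)) (at t)" for t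
    unfolding x_def z_def using DERIV_cdivide[OF dl[OF dY[of t]], of "Y 0" s0] by (simp add: det2.scaleR_left det2.minus_left)
  have dy: "(y has_real_derivative sqrt 3 * f t * w t) (at t)" for t
    unfolding y_def w_def using DERIV_cdivide[OF has_real_derivative_det2_right[OF dX[of t]], of "X 0" s0]
    by (simp add: det2.scaleR_right)
  have dw: "(w has_real_derivative - (sqrt 3 * f t * y t)) (at t)" for t
    unfolding y_def w_def using DERIV_cdivide[OF has_real_derivative_det2_right[OF dY[of t]], of "X 0" s0]
    by (simp add: det2.scaleR_right det2.minus_right)
  have init: "x 0 = 1" "z 0 = 0" "y 0 = 0" "w 0 = 1"
    using \<open>s0 \<noteq> 0\<close> by (simp_all add: x_def y_def z_def w_def s0_def)
  have "((\<lambda>t. x t * x t + z t * z t) has_real_derivative 0) (at t)"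
    "((\<lambda>t. y t * y t + w t * w t) has_real_derivative 0) (at t)"
    "((\<lambda>t. x t * y t + z t * w t) has_real_derivative 0) (at t)" for t
    using DERIV_add[OF DERIV_mult[OF dx dx] DERIV_mult[OF dz dz], of t]
      DERIV_add[OF DERIV_mult[OF dy dy] DERIV_mult[OF dw dw], of t]
      DERIV_add[OF DERIV_mult[OF dx dy] DERIV_mult[OF dz dw], of t]
    by (simp_all add: algebra_simps)
  then have inv: "x t * x t + z t * z t = 1" "y t * y t + w t * w t = 1" "x t * y t + z t * w t = 0" for t
    using DERIV_isconst_all[of "\<lambda>t. x t * x t + z t * z t" t 0] DERIV_isconst_all[of "\<lambda>t. y t * y t + w t * w t" t 0]
      DERIV_isconst_all[of "\<lambda>t. x t * y t + z t * w t" t 0]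
    by (auto simp: init)
  \<comment> \<open>The invariants say that the matrix with rows \<open>(x, z)\<close> and
    \<open>(y, w)\<close> has orthonormal rows; hence its first column has length one as
    well.\<close>
  have circle: "x t * x t + y t * y t = 1" for t
  proof -
    have "(x t * y t) * (x t * y t) = (z t * w t) * (z t * w t)"
      using inv(3)[of t] by (simp add: eq_neg_iff_add_eq_0[symmetric])
    also have "\<dots> = (z t * z t) * (w t * w t)" by simp
    also have "\<dots> = (1 - x t * x t) * (1 - y t * y t)"
    proof -
      have "z t * z t = 1 - x t * x t" "w t * w t = 1 - y t * y t" using inv(1,2)[of t] by linarith+
      then show ?thesis by simp
    qed
    finally show ?thesis by (simp add: algebra_simps)
  qed
  define M :: "real^2^2" where "M = (\<chi> i j. if j = 1 then X 0 $ i else Y 0 $ i)"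
  have "det M = s0" by (simp add: M_def det_2 s0_def det2_def)
  then have "invertible M" using \<open>s0 \<noteq> 0\<close> by (simp add: invertible_det_nz)
  moreover have "frontier K \<subseteq> (\<lambda>x. c0 + M *v x) ` sphere 0 1"
  proof
    fix p assume "p \<in> frontier K"
    then obtain t where t: "\<gamma> t = p" using \<gamma>_surj by metis
    let ?u = "vector [x t, y t] :: real^2"
    have "norm ?u = 1"
      using circle[of t] by (simp add: norm_eq_sqrt_inner inner_vec_def sum_2)
    moreover have "M *v ?u = x t *\<^sub>R X 0 + y t *\<^sub>R Y 0"
      by (simp add: M_def matrix_vector_mult_def vec_eq_iff sum_2 forall_2 mult.commute)
    moreover have "x t *\<^sub>R X 0 + y t *\<^sub>R Y 0 = X t"
    proof -
      have "det2 (X t) (Y 0) *\<^sub>R X 0 + det2 (X 0) (X t) *\<^sub>R Y 0 = s0 *\<^sub>R X t"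
        by (simp add: s0_def det2_def vec_eq_iff forall_2 algebra_simps)
      then have "(1 / s0) *\<^sub>R (det2 (X t) (Y 0) *\<^sub>R X 0 + det2 (X 0) (X t) *\<^sub>R Y 0) = (1 / s0) *\<^sub>R (s0 *\<^sub>R X t)"
        by simp
      then show ?thesis using \<open>s0 \<noteq> 0\<close> by (simp add: x_def y_def scaleR_add_right)
    qed
    ultimately show "p \<in> (\<lambda>x. c0 + M *v x) ` sphere 0 1"
      using t by (intro image_eqI[of _ _ ?u]) (auto simp: X_def)
  qed
  ultimately show thesis by (rule that)
qed

lemma is_ellipse_K:
  assumes "interior K \<noteq> {}"
  shows "is_ellipse K"
  using boundary_on_ellipse convex_body_eq_ellipse[OF compact_K convex_K assms]
  unfolding is_ellipse_def by metis

end

subsection \<open>Flotation levels, affine arc length and orientation\<close>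

lemma unitvec_surj:
  assumes "norm u = 1"
  obtains \<theta> where "unitvec \<theta> = u"
proof -
  have "(u$1)\<^sup>2 + (u$2)\<^sup>2 = 1"
    using assms by (simp add: norm_eq_sqrt_inner inner_vec_def sum_2 power2_eq_square)
  then obtain \<theta> where "u$1 = cos \<theta>" "u$2 = sin \<theta>" using sincos_total_2pi by metis
  then show thesis using that[of \<theta>] by (simp add: unitvec_def vec_eq_iff forall_2)
qed

text \<open>A line through an interior point is the only one in its direction cutting off that area, so
  the definite description in the definition of the flotation level is proper.\<close>

lemma flot_level_eq:
  assumes K: "compact K" and z: "z \<in> interior K" "z \<bullet> unitvec \<theta> = s"
    and m: "measure lebesgue (K \<inter> halfplane (unitvec \<theta>) s) = \<delta>"
  shows "flot_level K \<delta> \<theta> = s"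
proof -
  let ?u = "unitvec \<theta>"
  have uu: "?u \<bullet> ?u = 1"
    by (simp add: unitvec_def inner_vec_def sum_2 power2_eq_square[symmetric])
  have lm: "K \<inter> halfplane ?u r \<in> lmeasurable" for r
  proof -
    have "closed (halfplane ?u r)"
      unfolding halfplane_def by (intro closed_Collect_le continuous_intros)
    then show ?thesis using K by (intro lmeasurable_compact compact_Int_closed)
  qed
  have less: "measure lebesgue (K \<inter> halfplane ?u a) < measure lebesgue (K \<inter> halfplane ?u b)"
    if ab: "a < b" and s: "a \<le> s" "s \<le> b" for a b
  proof -
    obtain e where e: "0 < e" "ball z e \<subseteq> K" using z(1) mem_interior by blast
    define S where "S = ball z e \<inter> {x. a < x \<bullet> ?u \<and> x \<bullet> ?u < b}"
    have op: "open S"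
      unfolding S_def Collect_conj_eq by (intro open_Int open_Collect_less continuous_intros) auto
    have "\<exists>x. x \<in> S"
    proof -
      \<comment> \<open>A third of the width guarantees that a step of length \<open>h\<close> fits
        inside the strip on at least one side of level \<open>s\<close>, even when \<open>s\<close>
        is \<open>a\<close> or \<open>b\<close>.\<close>
      define h where "h = min (e/2) ((b - a)/3)"
      have h: "0 < h" "h < e" "2 * h < b - a" using e(1) ab by (auto simp: h_def min_def)
      have nu: "norm ?u = 1" using uu by (simp add: norm_eq_sqrt_inner)
      show ?thesis
      proof (cases "s + h < b")
        case True
        then have "z + h *\<^sub>R ?u \<in> S"
          using z(2) s h nu uu by (auto simp: S_def dist_norm inner_add_left)
        then show ?thesis by blast
      next
        case False
        then have "z - h *\<^sub>R ?u \<in> S"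
          using z(2) s h nu uu by (auto simp: S_def dist_norm inner_diff_left)
        then show ?thesis by blast
      qed
    qed
    then have "\<not> negligible S" using open_not_negligible[OF op] by blast
    moreover have Slm: "S \<in> lmeasurable"
      unfolding S_def using op by (intro bounded_set_imp_lmeasurable) (auto simp: S_def bounded_Int)
    ultimately have "0 < measure lebesgue S"
      using negligible_iff_measure by (metis measure_nonneg order_le_less)
    moreover have "measure lebesgue S + measure lebesgue (K \<inter> halfplane ?u a) = measure lebesgue (S \<union> (K \<inter> halfplane ?u a))"
    proof -
      have "S \<inter> (K \<inter> halfplane ?u a) = {}" by (auto simp: S_def halfplane_def)
      then show ?thesis by (simp add: measure_Un3[OF Slm lm[of a]])
    qed
    moreover have "\<dots> \<le> measure lebesgue (K \<inter> halfplane ?u b)"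
    proof (rule measure_mono_fmeasurable[OF _ _ lm])
      show "S \<union> (K \<inter> halfplane ?u a) \<subseteq> K \<inter> halfplane ?u b"
        using e(2) ab by (auto simp: S_def halfplane_def)
      show "S \<union> (K \<inter> halfplane ?u a) \<in> sets lebesgue"
        using Slm lm[of a] by blast
    qed
    ultimately show ?thesis by linarith
  qed
  show ?thesis
    unfolding flot_level_def
  proof (rule the_equality)
    show "measure lebesgue (K \<inter> halfplane ?u s) = \<delta>" by (rule m)
  next
    fix r assume r: "measure lebesgue (K \<inter> halfplane ?u r) = \<delta>"
    show "r = s" using less[of r s] less[of s r] m r by (cases r s rule: linorder_cases) auto
  qed
qed

section \<open>From half-planes and parameter sets to chords and arcs\<close>

context ccw_body begin

text \<open>\<theta> is the direction of the left normal of the chord. The interior midpoint lies on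
  the bounding line, which is what \<open>flot_level_eq\<close> needs to identify the level.\<close>

lemma cap_eq_halfplane:
  assumes c: "chord t s" and m: "measure lebesgue (cap t s) = \<delta>"
  obtains \<theta> where "\<And>x. x \<in> halfplane (unitvec \<theta>) (flot_level K \<delta> \<theta>) \<longleftrightarrow> det2 (\<gamma> s - \<gamma> t) (x - \<gamma> t) \<le> 0"
proof -
  let ?n = "rot (\<gamma> s - \<gamma> t)"
  have "\<gamma> s - \<gamma> t \<noteq> 0" using chord_det_pos[OF c] by (auto simp: det2.zero_left)
  then have n: "norm ?n > 0" by simp
  obtain \<theta> where \<theta>: "unitvec \<theta> = (1 / norm ?n) *\<^sub>R ?n"
    using unitvec_surj[of "(1 / norm ?n) *\<^sub>R ?n"] n by auto
  have iff: "x \<in> halfplane (unitvec \<theta>) (\<gamma> t \<bullet> unitvec \<theta>) \<longleftrightarrow> det2 (\<gamma> s - \<gamma> t) (x - \<gamma> t) \<le> 0" for x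
  proof -
    have "det2 (\<gamma> s - \<gamma> t) (x - \<gamma> t) = norm ?n * (x \<bullet> unitvec \<theta> - \<gamma> t \<bullet> unitvec \<theta>)"
      using n unfolding \<theta> det2_eq_inner_rot inner_diff_right by (simp add: inner_commute field_simps)
    then show ?thesis using n by (simp add: halfplane_def mult_le_0_iff)
  qed
  let ?m = "(1/2) *\<^sub>R (\<gamma> t + \<gamma> s)"
  have "flot_level K \<delta> \<theta> = \<gamma> t \<bullet> unitvec \<theta>"
  proof (rule flot_level_eq[OF compact_K])
    show "?m \<in> interior K" using c by (simp add: chord_def)
    have "det2 (\<gamma> s - \<gamma> t) (?m - \<gamma> t) = 0" by (simp add: det2_def field_simps)
    then have "(?m - \<gamma> t) \<bullet> unitvec \<theta> = 0" by (simp add: \<theta> det2_eq_inner_rot inner_commute)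
    then show "?m \<bullet> unitvec \<theta> = \<gamma> t \<bullet> unitvec \<theta>" by (simp add: inner_diff_left)
    have "K \<inter> halfplane (unitvec \<theta>) (\<gamma> t \<bullet> unitvec \<theta>) = cap t s" using iff by (auto simp: cap_def)
    then show "measure lebesgue (K \<inter> halfplane (unitvec \<theta>) (\<gamma> t \<bullet> unitvec \<theta>)) = \<delta>" using m by simp
  qed
  then show thesis using that[of \<theta>] iff by simp
qed

lemma integral_root_curv:
  assumes "a \<le> b"
  shows "((\<lambda>t. root 3 (curv t)) has_integral (\<sigma> b - \<sigma> a)) {a..b}"
  using assms deriv_\<sigma>
  by (intro fundamental_theorem_of_calculus)
    (auto simp: has_real_derivative_iff_has_vector_derivative[symmetric] intro: has_field_derivative_at_within)

text \<open>The arc is given by a condition on the parameters in \<open>{0..L}\<close>, where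
  \<open>0\<close> and \<open>L\<close> name the same point. It is therefore an interval up to end
  points, or two intervals when the chord passes beyond \<open>L\<close>.\<close>

lemma affine_length_arc:
  assumes "0 \<le> t" "t < L" and c: "chord t s"
  shows "integral {\<tau> \<in> {0..L}. det2 (\<gamma> s - \<gamma> t) (\<gamma> \<tau> - \<gamma> t) \<le> 0} (\<lambda>t. root 3 (curv t)) = \<sigma> s - \<sigma> t"
proof -
  let ?Q = "{\<tau> \<in> {0..L}. det2 (\<gamma> s - \<gamma> t) (\<gamma> \<tau> - \<gamma> t) \<le> 0}" and ?k = "\<lambda>t. root 3 (curv t)"
  have ts: "t < s" "s < t + L" using c by (auto simp: chord_def)
  have in_arc: "det2 (\<gamma> s - \<gamma> t) (\<gamma> \<tau> - \<gamma> t) \<le> 0" if "t \<le> \<tau>" "\<tau> \<le> s" for \<tau>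
    using chord_side_neg[OF c, of \<tau>] that by (cases "\<tau> = t \<or> \<tau> = s") (auto simp: det2.zero_right)
  have out_arc: "\<not> det2 (\<gamma> s - \<gamma> t) (\<gamma> \<tau> - \<gamma> t) \<le> 0" if "s < \<tau>" "\<tau> < t + L" for \<tau>
    using chord_side_pos[OF c that] by simp
  show ?thesis
  proof (cases "s \<le> L")
    case True
    have "{x \<in> {t..s} - ?Q. ?k x \<noteq> 0} = {}"
      using in_arc True assms by auto
    then have n1: "negligible {x \<in> {t..s} - ?Q. ?k x \<noteq> 0}" by (metis negligible_empty)
    \<comment> \<open>An extra parameter occurs only when the arc starts at \<open>0\<close>, which
      brings in \<open>L\<close>, or ends at \<open>L\<close>, which brings in
      \<open>0\<close>.\<close>
    have "{x \<in> ?Q - {t..s}. ?k x \<noteq> 0} \<subseteq> {0, L}"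
    proof
      fix \<tau> assume "\<tau> \<in> {x \<in> ?Q - {t..s}. ?k x \<noteq> 0}"
      then have \<tau>: "0 \<le> \<tau>" "\<tau> \<le> L" "det2 (\<gamma> s - \<gamma> t) (\<gamma> \<tau> - \<gamma> t) \<le> 0" "\<tau> < t \<or> s < \<tau>" by auto
      from \<tau>(4) show "\<tau> \<in> {0, L}"
      proof
        assume less: "\<tau> < t"
        have "\<not> s < \<tau> + L" using out_arc[of "\<tau> + L"] less \<tau>(3) unfolding periodic by auto
        then show ?thesis using \<tau>(1) True by simp
      next
        assume "s < \<tau>"
        then have "\<not> \<tau> < t + L" using out_arc[of \<tau>] \<tau>(3) by blast
        then show ?thesis using \<tau>(2) assms(1) by simp
      qed
    qed
    then have n2: "negligible {x \<in> ?Q - {t..s}. ?k x \<noteq> 0}"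
      by (rule negligible_subset[rotated]) simp
    have "(?k has_integral (\<sigma> s - \<sigma> t)) ?Q"
      using has_integral_spike_set_eq[OF n1 n2] integral_root_curv[of t s] ts by simp
    then show ?thesis by (rule integral_unique)
  next
    case False
    have Q: "?Q = {0..s - L} \<union> {t..L}"
    proof (intro equalityI subsetI)
      fix \<tau> assume \<tau>: "\<tau> \<in> ?Q"
      show "\<tau> \<in> {0..s - L} \<union> {t..L}"
      proof (rule ccontr)
        assume n: "\<tau> \<notin> {0..s - L} \<union> {t..L}"
        then have "s < \<tau> + L" "\<tau> + L < t + L" using \<tau> by auto
        then show False using out_arc[of "\<tau> + L"] \<tau> unfolding periodic by auto
      qed
    next
      fix \<tau> assume "\<tau> \<in> {0..s - L} \<union> {t..L}"
      then show "\<tau> \<in> ?Q"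
      proof
        assume "\<tau> \<in> {0..s - L}"
        then show ?thesis using in_arc[of "\<tau> + L"] assms ts unfolding periodic by auto
      next
        assume "\<tau> \<in> {t..L}"
        then show ?thesis using in_arc[of \<tau>] False assms by auto
      qed
    qed
    have "(?k has_integral ((\<sigma> (s - L) - \<sigma> 0) + (\<sigma> L - \<sigma> t))) ({0..s - L} \<union> {t..L})"
    proof (rule has_integral_Un)
      have "{0..s - L} \<inter> {t..L} = {}" using ts by auto
      then show "negligible ({0..s - L} \<inter> {t..L})" by simp
    qed (use integral_root_curv False assms in auto)
    then have "integral ?Q ?k = (\<sigma> (s - L) - \<sigma> 0) + (\<sigma> L - \<sigma> t)" unfolding Q by (rule integral_unique)
    then show ?thesis using \<sigma>_shift[of "s - L"] by simp
  qed
qed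

lemma affine_length_eq: "affine_length \<gamma> T = integral T (\<lambda>t. root 3 (curv t))"
proof -
  have "vector_derivative \<gamma> (at t) = \<gamma>1 t" "vector_derivative \<gamma>1 (at t) = \<gamma>2 t" for t
    using deriv_\<gamma> deriv_\<gamma>1 by (auto intro: vector_derivative_at)
  then show ?thesis by (simp add: affine_length_def curv_def)
qed

lemma chord_shift: "chord (t + of_int n * L) (s + of_int n * L) \<longleftrightarrow> chord t s"
  by (auto simp: chord_def periodic_int)

lemma \<sigma>_diff_shift: "\<sigma> (s + of_int n * L) - \<sigma> (t + of_int n * L) = \<sigma> s - \<sigma> t"
proof -
  let ?f = "\<lambda>u. \<sigma> (u + (s - t)) - \<sigma> u"
  have "?f (u + L) = ?f u" for u
    using \<sigma>_shift[of "u + (s - t)"] \<sigma>_shift[of u] by (simp add: algebra_simps)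
  from periodic_add_int[of ?f L, OF this, of t n] show ?thesis by (simp add: algebra_simps)
qed

theorem is_ellipse_of_affine_third:
  assumes "interior K \<noteq> {}" and \<delta>: "0 < \<delta>" "\<delta> < measure lebesgue K"
    and third: "\<And>\<theta>. affine_length \<gamma> {t \<in> {0..L}. \<gamma> t \<in> halfplane (unitvec \<theta>) (flot_level K \<delta> \<theta>)}
              = affine_length \<gamma> {0..L} / 3"
  shows "is_ellipse K"
proof -
  \<comment> \<open>The hypothesis sees only parameters in one period; chords starting elsewhere are
    reduced to this case by a shift through whole periods.\<close>
  have base: "\<sigma> s - \<sigma> t = (\<sigma> L - \<sigma> 0) / 3"
    if "0 \<le> t" "t < L" and c: "chord t s" "measure lebesgue (cap t s) = \<delta>" for t s
  proof -
    obtain \<theta> where \<theta>: "\<And>x. x \<in> halfplane (unitvec \<theta>) (flot_level K \<delta> \<theta>) \<longleftrightarrow> det2 (\<gamma> s - \<gamma> t) (x - \<gamma> t) \<le> 0"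
      using cap_eq_halfplane[OF c] by blast
    have "affine_length \<gamma> {0..L} = \<sigma> L - \<sigma> 0"
      unfolding affine_length_eq using integral_root_curv[of 0 L] L_pos by (simp add: integral_unique)
    then show ?thesis
      using third[of \<theta>] affine_length_arc[OF that(1-3)] unfolding \<theta> affine_length_eq by simp
  qed
  interpret equiaffine_flotation K L \<gamma> \<gamma>1 \<gamma>2 \<delta>
  proof
    fix t s assume c: "chord t s" "measure lebesgue (cap t s) = \<delta>"
    obtain n :: int where n: "0 \<le> t + of_int n * L" "t + of_int n * L < 0 + L" by (rule shift_to_period)
    have "cap (t + of_int n * L) (s + of_int n * L) = cap t s" by (simp add: cap_def periodic_int)
    then have "\<sigma> (s + of_int n * L) - \<sigma> (t + of_int n * L) = (\<sigma> L - \<sigma> 0) / 3"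
      using c n by (intro base) (auto simp: chord_shift)
    then show "\<sigma> s - \<sigma> t = (\<sigma> L - \<sigma> 0) / 3" by (simp only: \<sigma>_diff_shift)
  qed (use \<delta> in auto)
  show ?thesis by (rule is_ellipse_K[OF assms(1)])
qed

end

section \<open>Orientation of the boundary\<close>

text \<open>A supporting line at a boundary point must be the tangent, so the body lies on one side
  of it. Which side is told by the sign of \<open>?s t\<close> for a fixed interior point
  \<open>z\<close>; being continuous and never zero, \<open>?s\<close> has one sign for all
  \<open>t\<close>.\<close>

lemma convex_boundary_orientation:
  fixes \<gamma> \<gamma>1 :: "real \<Rightarrow> real^2"
  assumes K: "convex K" "closed K" "interior K \<noteq> {}"
    and d: "\<And>t. (\<gamma> has_vector_derivative \<gamma>1 t) (at t)"
    and d1: "continuous_on UNIV \<gamma>1"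
    and reg: "\<And>t. \<gamma>1 t \<noteq> 0"
    and fr: "\<And>t. \<gamma> t \<in> frontier K"
  shows "(\<forall>t. \<forall>x\<in>K. 0 \<le> det2 (\<gamma>1 t) (x - \<gamma> t)) \<or> (\<forall>t. \<forall>x\<in>K. det2 (\<gamma>1 t) (x - \<gamma> t) \<le> 0)"
proof -
  obtain z where z: "z \<in> interior K" using K(3) by blast
  have inK: "\<gamma> t \<in> K" for t using fr K(2) frontier_subset_closed by blast
  let ?s = "\<lambda>t. det2 (\<gamma>1 t) (z - \<gamma> t)"
  \<comment> \<open>\<open>c\<close> is the signed factor between the supporting normal and the left
    normal; its sign is that of the orientation at \<open>t\<close>.\<close>
  have supp: "\<exists>c. 0 < c * ?s t \<and> (\<forall>x\<in>K. 0 \<le> c * det2 (\<gamma>1 t) (x - \<gamma> t))" for t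
  proof -
    have "\<gamma> t \<notin> rel_interior K" using fr[of t] K(3) by (simp add: rel_interior_nonempty_interior frontier_def)
    then obtain n where n: "n \<noteq> 0" "\<And>y. y \<in> K \<Longrightarrow> n \<bullet> \<gamma> t \<le> n \<bullet> y"
      using supporting_hyperplane_rel_boundary[OF K(1) inK] by metis
    have "((\<lambda>s. n \<bullet> \<gamma> s) has_real_derivative n \<bullet> \<gamma>1 t) (at t)"
      using bounded_linear.has_vector_derivative[OF bounded_linear_inner_right d]
      by (simp add: has_real_derivative_iff_has_vector_derivative)
    then have "n \<bullet> \<gamma>1 t = 0" by (rule DERIV_local_min[of _ _ _ 1]) (use n(2) inK in auto)
    then have "det2 (rot (\<gamma>1 t)) n = 0" by (simp add: det2_def rot_def inner_vec_def sum_2 algebra_simps)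
    then obtain c where c: "n = c *\<^sub>R rot (\<gamma>1 t)" using det2_eq_0_imp_scaleR reg rot_eq_0_iff by metis
    have eq: "n \<bullet> (x - \<gamma> t) = c * det2 (\<gamma>1 t) (x - \<gamma> t)" for x
      by (simp add: c det2_eq_inner_rot)
    obtain e where e: "0 < e" "cball z e \<subseteq> K" using z mem_interior_cball by blast
    have "z - (e / norm n) *\<^sub>R n \<in> cball z e" using e(1) n(1) by (simp add: dist_norm)
    then have "n \<bullet> \<gamma> t \<le> n \<bullet> (z - (e / norm n) *\<^sub>R n)" using e(2) n(2) by blast
    moreover have "0 < (e / norm n) * (n \<bullet> n)" using e(1) n(1) by simp
    ultimately have "0 < n \<bullet> (z - \<gamma> t)" by (simp add: inner_diff_right)
    moreover have "0 \<le> n \<bullet> (x - \<gamma> t)" if "x \<in> K" for x using n(2)[OF that] by (simp add: inner_diff_right)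
    ultimately show ?thesis unfolding eq by blast
  qed
  have cont: "continuous_on S ?s" for S
    using d d1 by (intro det2.continuous_on continuous_intros continuous_on_subset[OF d1]
        continuous_at_imp_continuous_on) (auto intro: has_vector_derivative_continuous)
  have nz: "?s t \<noteq> 0" for t using supp[of t] by auto
  have same: "0 < ?s a \<longleftrightarrow> 0 < ?s b" if "a \<le> b" for a b
  proof (rule ccontr)
    assume "\<not> ?thesis"
    then consider "?s a < 0" "0 < ?s b" | "0 < ?s a" "?s b < 0" using nz[of a] nz[of b] by linarith
    then show False
    proof cases
      case 1
      then show False using IVT'[of ?s a 0 b] that cont nz by auto
    next
      case 2
      then show False using IVT2'[of ?s b 0 a] that cont nz by auto
    qed
  qed
  show ?thesis
  proof (cases "0 < ?s 0")
    case True
    have "0 \<le> det2 (\<gamma>1 t) (x - \<gamma> t)" if "x \<in> K" for t x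
    proof -
      have "0 < ?s t" using same[of 0 t] same[of t 0] True by (cases "0 \<le> t") auto
      then show ?thesis using supp[of t] that by (auto simp: zero_less_mult_iff zero_le_mult_iff)
    qed
    then show ?thesis by blast
  next
    case False
    have "det2 (\<gamma>1 t) (x - \<gamma> t) \<le> 0" if "x \<in> K" for t x
    proof -
      have "?s t < 0" using same[of 0 t] same[of t 0] False nz[of t] by (cases "0 \<le> t") auto
      then show ?thesis using supp[of t] that by (auto simp: zero_less_mult_iff zero_le_mult_iff)
    qed
    then show ?thesis by blast
  qed
qed

lemma integral_reverse:
  fixes f :: "real \<Rightarrow> real"
  shows "integral {0..L} (\<lambda>t. f (L - t)) = integral {0..L} f"
proof -
  have "integral {0..L} f = integral {-L + L..0 + L} f" by simp
  also have "\<dots> = integral {-L..-0} (f \<circ> (+) L)" using integral_shift_Icc_real[of "-L" 0 f L] by simp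
  also have "\<dots> = integral {-L..-0} (\<lambda>t. (\<lambda>s. f (L - s)) (- t))" by (simp add: o_def)
  also have "\<dots> = integral {0..L} (\<lambda>t. f (L - t))" by (rule Henstock_Kurzweil_Integration.integral_reflect_real)
  finally show ?thesis by simp
qed

text \<open>Reversal negates the velocity and keeps the acceleration, so the determinant changes
  sign, and the odd root passes this on. Partial and total affine length flip together, leaving the
  one-third condition intact.\<close>

lemma affine_length_reverse:
  assumes d: "\<And>t. (\<gamma> has_vector_derivative \<gamma>1 t) (at t)" and d1: "\<And>t. (\<gamma>1 has_vector_derivative \<gamma>2 t) (at t)"
    and r: "\<And>t. ((\<lambda>t. \<gamma> (L - t)) has_vector_derivative - \<gamma>1 (L - t)) (at t)"
    and r1: "\<And>t. ((\<lambda>t. - \<gamma>1 (L - t)) has_vector_derivative \<gamma>2 (L - t)) (at t)"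
  shows "affine_length (\<lambda>t. \<gamma> (L - t)) {t \<in> {0..L}. \<gamma> (L - t) \<in> H} = - affine_length \<gamma> {t \<in> {0..L}. \<gamma> t \<in> H}"
proof -
  let ?k = "\<lambda>t. root 3 (det2 (\<gamma>1 t) (\<gamma>2 t))"
  let ?f = "\<lambda>t. if t \<in> {t. \<gamma> t \<in> H} then ?k t else 0"
  have v: "vector_derivative \<gamma> (at t) = \<gamma>1 t" "vector_derivative \<gamma>1 (at t) = \<gamma>2 t"
    "vector_derivative (\<lambda>t. \<gamma> (L - t)) (at t) = - \<gamma>1 (L - t)"
    "vector_derivative (\<lambda>t. - \<gamma>1 (L - t)) (at t) = \<gamma>2 (L - t)" for t
    using d d1 r r1 by (auto intro: vector_derivative_at)
  have restr: "integral {t \<in> {0..L}. t \<in> S} g = integral {0..L} (\<lambda>t. if t \<in> S then g t else 0)"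
    for S and g :: "real \<Rightarrow> real"
    using integral_restrict_Int[of "{0..L}" S g] by (simp add: Int_def conj_commute)
  have "affine_length (\<lambda>t. \<gamma> (L - t)) {t \<in> {0..L}. t \<in> {t. \<gamma> (L - t) \<in> H}}
      = integral {t \<in> {0..L}. t \<in> {t. \<gamma> (L - t) \<in> H}} (\<lambda>t. - ?k (L - t))"
    unfolding affine_length_def v by (simp add: det2.minus_left real_root_minus)
  also have "\<dots> = integral {0..L} (\<lambda>t. - ?f (L - t))"
    unfolding restr by (intro integral_cong) simp
  also have "\<dots> = - integral {0..L} (\<lambda>t. ?f (L - t))" by (rule integral_neg)
  also have "\<dots> = - integral {0..L} ?f" by (subst integral_reverse) (rule refl)
  also have "\<dots> = - affine_length \<gamma> {t \<in> {0..L}. t \<in> {t. \<gamma> t \<in> H}}"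
    unfolding restr affine_length_def v ..
  finally show ?thesis by simp
qed

theorem theorem4p15:
  fixes K :: "(real^2) set" and \<delta> L :: real and \<gamma> :: "real \<Rightarrow> real^2"
  assumes "convex_body K"
    and "C2_boundary_param K L \<gamma>"
    and "0 < \<delta>" and "\<delta> < measure lebesgue K"
    and "homothetic (Pi_delta K \<delta>) (Gamma_delta K \<delta>)"
    and "\<forall>\<theta>. affine_length \<gamma> {t \<in> {0..L}. \<gamma> t \<in> halfplane (unitvec \<theta>) (flot_level K \<delta> \<theta>)}
              = affine_length \<gamma> {0..L} / 3"
  shows "is_ellipse K"
proof -
  have K: "compact K" "convex K" "interior K \<noteq> {}" "closed K"
    using assms(1) by (auto simp: convex_body_def compact_imp_closed)
  obtain \<gamma>1 \<gamma>2 where \<gamma>: "0 < L" "\<And>t. (\<gamma> has_vector_derivative \<gamma>1 t) (at t)"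
      "\<And>t. (\<gamma>1 has_vector_derivative \<gamma>2 t) (at t)" "continuous_on UNIV \<gamma>2" "\<And>t. \<gamma>1 t \<noteq> 0"
      "\<And>t. \<gamma> (t + L) = \<gamma> t" "inj_on \<gamma> {0..<L}" "\<gamma> ` {0..L} = frontier K"
    using assms(2) unfolding C2_boundary_param_def by blast
  have fr: "\<gamma> t \<in> frontier K" for t
  proof -
    define n where "n = - \<lfloor>t / L\<rfloor>"
    have "0 \<le> t + of_int n * L" "t + of_int n * L \<le> L"
      using floor_divide_lower[OF \<gamma>(1), of t] floor_divide_upper[OF \<gamma>(1), of t]
      by (simp_all add: n_def algebra_simps)
    then have "\<gamma> (t + of_int n * L) \<in> frontier K" unfolding \<gamma>(8)[symmetric] by auto
    then show ?thesis by (simp add: periodic_add_int[of \<gamma> L, OF \<gamma>(6)])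
  qed
  have cont: "continuous_on UNIV \<gamma>1"
    using \<gamma>(3) by (auto intro!: continuous_at_imp_continuous_on intro: has_vector_derivative_continuous)
  consider "\<And>t x. x \<in> K \<Longrightarrow> 0 \<le> det2 (\<gamma>1 t) (x - \<gamma> t)" | "\<And>t x. x \<in> K \<Longrightarrow> det2 (\<gamma>1 t) (x - \<gamma> t) \<le> 0"
    using convex_boundary_orientation[OF K(2,4,3) \<gamma>(2) cont \<gamma>(5) fr] by blast
  then show ?thesis
  proof cases
    case 1
    interpret ccw_body K L \<gamma> \<gamma>1 \<gamma>2
      using K \<gamma> 1 by unfold_locales
    show ?thesis using is_ellipse_of_affine_third[OF K(3) assms(3,4)] assms(6) by blast
  next
    case 2
    let ?\<gamma> = "\<lambda>t. \<gamma> (L - t)" and ?\<gamma>1 = "\<lambda>t. - \<gamma>1 (L - t)" and ?\<gamma>2 = "\<lambda>t. \<gamma>2 (L - t)"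
    have neg: "((\<lambda>t. L - t) has_real_derivative -1) (at t)" for t
      by (auto intro!: derivative_eq_intros)
    have r: "(?\<gamma> has_vector_derivative ?\<gamma>1 t) (at t)" for t
      using has_vector_derivative_compose_real[OF \<gamma>(2) neg, of t] by simp
    have r1: "(?\<gamma>1 has_vector_derivative ?\<gamma>2 t) (at t)" for t
      using has_vector_derivative_minus[OF has_vector_derivative_compose_real[OF \<gamma>(3) neg, of t]] by simp
    interpret ccw_body K L ?\<gamma> ?\<gamma>1 ?\<gamma>2
    proof
      show "continuous_on UNIV ?\<gamma>2"
        by (rule continuous_on_compose2[OF \<gamma>(4)]) (auto intro!: continuous_intros)
      show "?\<gamma> (t + L) = ?\<gamma> t" for t using \<gamma>(6)[of "- t"] by (simp add: algebra_simps)
      show "inj_on ?\<gamma> {0..<L}"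
      proof (rule inj_onI)
        fix s t assume st: "s \<in> {0..<L}" "t \<in> {0..<L}" and eq: "\<gamma> (L - s) = \<gamma> (L - t)"
        have L0: "\<gamma> L = \<gamma> 0" using \<gamma>(6)[of 0] by simp
        \<comment> \<open>The reflection sends \<open>0\<close> to \<open>L\<close>, outside the
          half-open period, so \<open>0\<close> is kept fixed; \<gamma> takes the same value at
          both.\<close>
        define r where "r s = (if s = 0 then 0 else L - s)" for s
        have "\<gamma> (r s) = \<gamma> (r t)" using eq L0 by (auto simp: r_def)
        moreover have "r s \<in> {0..<L}" "r t \<in> {0..<L}" using st \<gamma>(1) by (auto simp: r_def)
        ultimately have "r s = r t" using inj_onD[OF \<gamma>(7)] by blast
        then show "s = t" using st by (auto simp: r_def split: if_splits)
      qed
      have "(\<lambda>t. L - t) ` {0..L} = {0..L}" using image_diff_atLeastAtMost[of L 0 L] by simp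
      then show "?\<gamma> ` {0..L} = frontier K" using \<gamma>(8) by (metis image_image)
      show "0 \<le> det2 (?\<gamma>1 t) (x - ?\<gamma> t)" if "x \<in> K" for t x
        using 2[OF that] by (simp add: det2.minus_left)
    qed (use K \<gamma>(1,5) r r1 in auto)
    note rev = affine_length_reverse[OF \<gamma>(2,3) r r1]
    have total: "affine_length ?\<gamma> {0..L} = - affine_length \<gamma> {0..L}"
      using rev[of UNIV] by (simp only: UNIV_I simp_thms Collect_mem_eq)
    have "affine_length ?\<gamma> {t \<in> {0..L}. ?\<gamma> t \<in> halfplane (unitvec \<theta>) (flot_level K \<delta> \<theta>)}
        = affine_length ?\<gamma> {0..L} / 3" for \<theta>
      using assms(6) rev[of "halfplane (unitvec \<theta>) (flot_level K \<delta> \<theta>)"] total by simp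
    then show ?thesis by (rule is_ellipse_of_affine_third[OF K(3) assms(3,4)])
  qed
qed

end
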